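(* Assume that $p,q\in\mathbb{C}$. (i) If $p>0$ and $q>0$, then $$\tilde I_{p,q}^{\pm}:=Os\text{-}\int_0^\infty e^{\pm i x^p}x^{q-1}\,dx=p^{-1}e^{\pm i\frac{\pi}{2}\frac{q}{p}}\,\Gamma\!\left(\frac{q}{p}\right).$$ (ii) By analytic continuation, $\tilde I_{p,q}^{\pm}$ can be extended to be non-zero meromorphic on $\mathbb{C}$ with poles of order $1$ at $q=-pj$ for $j\in\mathbb{N}$, as a function of $q$, for each $p\in\mathbb{C}\setminus\{0\}$; and to be meromorphic on $\mathbb{C}\setminus\{0\}$ with poles of order $1$ at $p=-q/j$ for $j\in\mathbb{N}$, as a function of $p$, for each $q\in\mathbb{C}$. Here the double signs $\pm$ are in the same order. The $\tilde I_{p,q}^{\pm}$ are called generalized Fresnel integrals.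
   Context: $\mathbb{N}$ is the set of natural numbers $\{1,2,3,\dots\}$; $\Gamma$ is the Gamma function; $\mathcal{S}(\mathbb{R})$ is the Schwartz space. The oscillatory integral is defined by $$Os\text{-}\int_0^\infty e^{\pm i x^p}x^{q-1}\,dx:=\lim_{\varepsilon\to+0}\int_0^\infty e^{\pm i x^p}x^{q-1}\chi(\varepsilon x)\,dx,$$ where $\chi\in\mathcal{S}(\mathbb{R})$ with $\chi(0)=1$ and $0<\varepsilon<1$; it is said to exist if this limit of improper integrals exists and is independent of the choice of $\chi$.
   Formalization: The poles in q are taken to be q=-pj for j≥1 together with q=0, also simple, which the printed list omits (Γ(q/p) has a pole there); for q=0, where Γ(0)/p is undefined for every p, the function of p is by convention zero, with no poles. *)

theory Defs
  imports "HOL-Complex_Analysis.Complex_Analysis"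
begin

definition iter_deriv :: "nat \<Rightarrow> (real \<Rightarrow> complex) \<Rightarrow> real \<Rightarrow> complex" where
  "iter_deriv n f = ((\<lambda>g x. vector_derivative g (at x)) ^^ n) f"

text \<open>The Schwartz space of complex-valued functions on the real line. The first conjunct says
  that all iterated derivatives exist, so the values of \<^const>\<open>iter_deriv\<close> in the second
  one are genuine derivatives.\<close>

definition schwartz :: "(real \<Rightarrow> complex) set" where
  "schwartz = {f. (\<forall>n x. iter_deriv n f differentiable (at x)) \<and>
                  (\<forall>k n. bounded (range (\<lambda>x. x ^ k *\<^sub>R iter_deriv n f x)))}"

text \<open>The oscillatory integral of \<open>f\<close> over the positive half-line exists and equals \<open>I\<close>: the
  regularised integrals converge to the same \<open>I\<close> for every cutoff function. The improper integrals
  are Henstock-Kurzweil integrals over the open half-line, which need no separate limits at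
  the two endpoints.\<close>

definition has_Os_integral :: "(real \<Rightarrow> complex) \<Rightarrow> complex \<Rightarrow> bool" where
  "has_Os_integral f I \<longleftrightarrow>
     (\<forall>\<psi>\<in>schwartz. \<psi> 0 = 1 \<longrightarrow>
        (\<forall>\<epsilon>. 0 < \<epsilon> \<and> \<epsilon> < 1 \<longrightarrow> (\<lambda>x. f x * \<psi> (\<epsilon> * x)) integrable_on {0<..}) \<and>
        ((\<lambda>\<epsilon>. integral {0<..} (\<lambda>x. f x * \<psi> (\<epsilon> * x))) \<longlongrightarrow> I) (at_right 0))"

text \<open>The integrand of the generalized Fresnel integrals; the double sign is a parameter
  \<open>s\<close> that is either \<open>1\<close> or \<open>- 1\<close>.\<close>

definition fresnel_integrand :: "real \<Rightarrow> real \<Rightarrow> real \<Rightarrow> real \<Rightarrow> complex" where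
  "fresnel_integrand s p q x =
     exp (of_real s * \<i> * of_real (x powr p)) * of_real (x powr (q - 1))"

text \<open>\<open>F p q\<close> is the analytic continuation, separately in each variable, of the generalized Fresnel
  integral from positive real \<open>p\<close>, \<open>q\<close>. Asking for \<^const>\<open>nicely_meromorphic_on\<close> rather
  than \<^const>\<open>meromorphic_on\<close> fixes the value \<open>0\<close> at poles and excludes removable
  singularities. By the identity theorem, applied first in \<open>q\<close> for positive \<open>p\<close> and
  then in \<open>p\<close>, this determines \<open>F p q\<close> for all \<open>q\<close> and all nonzero \<open>p\<close>. Each point \<open>(p, 0)\<close> with
  \<open>p\<close> positive is a pole in \<open>q\<close>, so \<open>\<lambda>p. F p 0\<close> vanishes identically off \<open>0\<close>.\<close>

definition is_fresnel_continuation :: "real \<Rightarrow> (complex \<Rightarrow> complex \<Rightarrow> complex) \<Rightarrow> bool" where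
  "is_fresnel_continuation s F \<longleftrightarrow>
     (\<forall>p q. 0 < p \<and> 0 < q \<longrightarrow>
        has_Os_integral (fresnel_integrand s p q) (F (of_real p) (of_real q))) \<and>
     (\<forall>p. p \<noteq> 0 \<longrightarrow> (\<lambda>q. F p q) nicely_meromorphic_on UNIV) \<and>
     (\<forall>q. (\<lambda>p. F p q) nicely_meromorphic_on - {0})"

end

theory Submission
  imports Defs
begin

text \<open>
  Let \<open>J q \<psi>\<close> be the integral regularised by \<open>\<psi> (\<epsilon> x)\<close>, \<open>a = q / p\<close> and \<open>s = \<plusminus>1\<close>. For \<open>0 < q < p\<close>,
  rotating the path of integration to a ray in the direction \<open>s \<i>\<close> gives a primitive of the
  integrand that is bounded, decays at infinity like \<open>x powr (q - p)\<close> and tends at \<open>0\<close> to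
  \<open>- exp (s \<i> \<pi> a / 2) \<Gamma>(a) / p\<close>; after one integration by parts the remainder is bounded by a
  positive power of \<open>\<epsilon>\<close>.

  Integrating the derivative of \<open>x powr q * exp (s \<i> x powr p) * \<psi> (\<epsilon> x)\<close> gives, for \<open>q > 0\<close>,
  \<open>s \<i> p J (q + p) \<psi> = - q J q \<psi> - J q (x \<psi>')\<close>. Since \<open>x \<psi>'\<close> is again a Schwartz function and
  vanishes at \<open>0\<close>, the limits satisfy the functional equation of \<open>\<Gamma>\<close>, which carries the result
  from \<open>q \<le> p\<close> to all \<open>q\<close>. The case \<open>q = p\<close> comes from the boundary case \<open>q = 0\<close> of the same identity.

  The closed form is the reciprocal of \<open>p exp (- s \<i> \<pi> q / (2 p)) / \<Gamma>(q / p)\<close>, which is analytic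
  with simple zeros in \<open>q\<close> and, for \<open>q \<noteq> 0\<close>, in \<open>p\<close>.
\<close>

subsection \<open>Schwartz functions and dilated cutoffs\<close>

abbreviation vderiv :: "(real \<Rightarrow> complex) \<Rightarrow> real \<Rightarrow> complex" where
  "vderiv \<psi> \<equiv> (\<lambda>x. vector_derivative \<psi> (at x))"

lemma iter_deriv_0 [simp]: "iter_deriv 0 f = f"
  by (simp add: iter_deriv_def)

lemma iter_deriv_Suc: "iter_deriv (Suc n) f = vderiv (iter_deriv n f)"
  by (simp add: iter_deriv_def)

lemma iter_deriv_vderiv: "iter_deriv n (vderiv f) = iter_deriv (Suc n) f"
  by (simp only: iter_deriv_def funpow_Suc_right o_apply)

lemma schwartz_vderiv:
  assumes "\<psi> \<in> schwartz"
  shows "vderiv \<psi> \<in> schwartz"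
proof -
  have "iter_deriv (Suc n) \<psi> differentiable (at x)"
    and "bounded (range (\<lambda>x. x ^ k *\<^sub>R iter_deriv (Suc n) \<psi> x))" for n k x
    using assms unfolding schwartz_def by blast+
  then show ?thesis
    unfolding schwartz_def mem_Collect_eq iter_deriv_vderiv by (intro conjI allI)
qed

lemma schwartz_has_vector_derivative:
  assumes "\<psi> \<in> schwartz"
  shows "(\<psi> has_vector_derivative vderiv \<psi> x) (at x within A)"
proof -
  have "iter_deriv 0 \<psi> differentiable (at x)"
    using assms unfolding schwartz_def by blast
  then have "(\<psi> has_vector_derivative vderiv \<psi> x) (at x)"
    by (simp add: vector_derivative_works)
  then show ?thesis by (rule has_vector_derivative_at_within)
qed

lemma schwartz_continuous_on: "\<psi> \<in> schwartz \<Longrightarrow> continuous_on A \<psi>"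
  by (rule continuous_on_vector_derivative) (rule schwartz_has_vector_derivative)

lemma schwartz_decay:
  assumes "\<psi> \<in> schwartz"
  obtains C where "\<And>x. x > 0 \<Longrightarrow> norm (\<psi> x) \<le> C * x powr (- real k)" "C \<ge> 0"
proof -
  have "bounded (range (\<lambda>x. x ^ k *\<^sub>R iter_deriv 0 \<psi> x))"
    using assms unfolding schwartz_def by blast
  then have "bounded (range (\<lambda>x. x ^ k *\<^sub>R \<psi> x))" by simp
  then obtain C where C: "norm (x ^ k *\<^sub>R \<psi> x) \<le> C" for x
    unfolding bounded_iff by blast
  show ?thesis
  proof
    show "norm (\<psi> x) \<le> C * x powr (- real k)" if "x > 0" for x
      using C[of x] that by (simp add: powr_minus powr_realpow field_simps)
    show "C \<ge> 0" using order_trans[OF norm_ge_zero C] .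
  qed
qed

text \<open>The Leibniz rule stops after two terms because the factor \<open>x\<close> has vanishing
  second derivative. For \<open>n = 0\<close> the truncated index \<open>n - 1\<close> is harmless,
  its term having coefficient 0.\<close>

lemma iter_deriv_scaleR_id:
  assumes "\<And>n x. iter_deriv n \<phi> differentiable (at x)"
  shows "iter_deriv n (\<lambda>x. x *\<^sub>R \<phi> x)
      = (\<lambda>x. x *\<^sub>R iter_deriv n \<phi> x + real n *\<^sub>R iter_deriv (n - 1) \<phi> x)"
proof (induction n)
  case 0
  then show ?case by simp
next
  case (Suc n)
  have d: "(iter_deriv m \<phi> has_vector_derivative iter_deriv (Suc m) \<phi> x) (at x)" for m x
    using assms[of m x] by (simp add: iter_deriv_Suc vector_derivative_works)
  have "((\<lambda>x. x *\<^sub>R iter_deriv n \<phi> x + real n *\<^sub>R iter_deriv (n - 1) \<phi> x) has_vector_derivative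
      (x *\<^sub>R iter_deriv (Suc n) \<phi> x + real (Suc n) *\<^sub>R iter_deriv n \<phi> x)) (at x)" for x
    using d[of 0] by (cases n) (auto intro!: derivative_eq_intros d simp: scaleR_conv_of_real
        algebra_simps)
  then show ?case
    unfolding iter_deriv_Suc[of n "\<lambda>x. x *\<^sub>R \<phi> x"] Suc
        by (intro ext) (simp add: vector_derivative_at del: of_nat_Suc)
qed

lemma schwartz_scaleR_id:
  assumes "\<phi> \<in> schwartz"
  shows "(\<lambda>x. x *\<^sub>R \<phi> x) \<in> schwartz"
proof -
  have d: "iter_deriv n \<phi> differentiable (at x)"
    and b: "bounded (range (\<lambda>x. x ^ k *\<^sub>R iter_deriv n \<phi> x))" for n k x
    using assms by (auto simp: schwartz_def)
  have "bounded (range (\<lambda>x. x ^ Suc k *\<^sub>R iter_deriv n \<phi> x + real n *\<^sub>R (x ^ k *\<^sub>R iter_deriv (n -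
      1) \<phi> x)))" for n k
    by (intro bounded_plus_comp bounded_scaleR_comp b)
  moreover have "x ^ k *\<^sub>R (x *\<^sub>R iter_deriv n \<phi> x + real n *\<^sub>R iter_deriv (n - 1) \<phi> x) =
      x ^ Suc k *\<^sub>R iter_deriv n \<phi> x + real n *\<^sub>R (x ^ k *\<^sub>R iter_deriv (n - 1) \<phi> x)" for x k n
    by (simp add: algebra_simps)
  moreover have "(\<lambda>x. x *\<^sub>R iter_deriv n \<phi> x + real n *\<^sub>R iter_deriv (n - 1) \<phi> x) differentiable
      (at x)" for n x
    by (intro differentiable_add differentiable_scaleR d) auto
  moreover have "iter_deriv n (\<lambda>x. x *\<^sub>R \<phi> x)
      = (\<lambda>x. x *\<^sub>R iter_deriv n \<phi> x + real n *\<^sub>R iter_deriv (n - 1) \<phi> x)" for n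
    by (rule iter_deriv_scaleR_id[of \<phi> n, OF d])
  ultimately show ?thesis
    by (simp add: schwartz_def)
qed

section \<open>Half-line integrals against a dilated cutoff\<close>

lemma FTC_halfline:
  fixes f F :: "real \<Rightarrow> complex"
  assumes "\<And>x. x > 0 \<Longrightarrow> (F has_vector_derivative f x) (at x)"
    and "continuous_on {0<..} f" "set_integrable lborel {0<..} f"
    and "(F \<longlongrightarrow> A) (at_right 0)" "(F \<longlongrightarrow> B) at_top"
  shows "(LINT x:{0<..}|lborel. f x) = B - A"
proof -
  have "(LBINT x=ereal 0..\<infinity>. f x) = B - A"
  proof (rule interval_integral_FTC_integrable)
    show "isCont f x" if "ereal 0 < ereal x" for x
      using assms(2) that by (simp add: continuous_on_eq_continuous_at)
    show "set_integrable lborel (einterval (ereal 0) \<infinity>) f"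
      using assms(3) by (simp add: einterval_def greaterThan_def)
  qed (use assms in \<open>auto simp: ereal_tendsto_simps\<close>)
  then show ?thesis
    by (simp add: interval_integral_to_infinity_eq)
qed

lemma set_integrable_powr_schwartz:
  assumes "q > 0" "\<phi> \<in> schwartz"
  shows "set_integrable lborel {0<..} (\<lambda>x. x powr (q - 1) * norm (\<phi> x))"
proof -
  \<comment> \<open>On \<open>(0, 1]\<close> boundedness of \<phi> suffices, as \<open>q > 0\<close>
    makes \<open>x powr (q - 1)\<close> integrable there. From 1 on, \<open>k \<ge> q + 1\<close>
    leaves an exponent of at most -2.\<close>
  obtain k :: nat where k: "real k \<ge> q + 1" using real_arch_simple by blast
  obtain C0 where C0: "\<And>x. x > 0 \<Longrightarrow> norm (\<phi> x) \<le> C0 * x powr (- real 0)" "C0 \<ge> 0"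
    using schwartz_decay[OF assms(2)] by blast
  obtain C1 where C1: "\<And>x. x > 0 \<Longrightarrow> norm (\<phi> x) \<le> C1 * x powr (- real k)" "C1 \<ge> 0"
    using schwartz_decay[OF assms(2)] by blast
  have c: "continuous_on A \<phi>" for A by (rule schwartz_continuous_on[OF assms(2)])
  have m: "set_borel_measurable lborel A (\<lambda>x. x powr (q - 1) * norm (\<phi> x))"
    if "A \<in> sets borel" "A \<subseteq> {0<..}" for A
    using that unfolding set_borel_measurable_def measurable_lborel2
    by (intro borel_measurable_continuous_on_indicator continuous_intros c) auto
  have "set_integrable lborel {0<..1} (\<lambda>x. x powr (q - 1) * norm (\<phi> x))"
  proof (rule set_integrable_bound)
    have "(\<lambda>x. C0 * x powr (q - 1)) absolutely_integrable_on {0<..1}"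
      using assms C0 integrable_on_powr_from_0'[of "q - 1" 1]
      by (intro nonnegative_absolutely_integrable_1 integrable_on_mult_right) auto
    then show "set_integrable lborel {0<..1} (\<lambda>x. C0 * x powr (q - 1))"
      unfolding set_integrable_def by (subst (asm) integrable_completion) auto
    show "AE x in lborel. x \<in> {0<..1} \<longrightarrow> norm (x powr (q - 1) * norm (\<phi> x))
        \<le> norm (C0 * x powr (q - 1))"
      using C0 by (auto simp: mult.commute intro!: AE_I2 mult_mono)
  qed (rule m; auto)
  moreover have "set_integrable lborel {1..} (\<lambda>x. x powr (q - 1) * norm (\<phi> x))"
  proof (rule set_integrable_bound)
    have "(\<lambda>x. C1 * x powr (-2)) absolutely_integrable_on {1..}"
      using C1 has_integral_powr_to_inf[of "-2" 1]
      by (intro nonnegative_absolutely_integrable_1 integrable_on_mult_right) auto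
    then show "set_integrable lborel {1..} (\<lambda>x. C1 * x powr (-2))"
      unfolding set_integrable_def by (subst (asm) integrable_completion) auto
    have "x powr (q - 1) * norm (\<phi> x) \<le> C1 * x powr (-2)" if "x \<ge> 1" for x
    proof -
      have "x powr (q - 1) * norm (\<phi> x) \<le> x powr (q - 1) * (C1 * x powr (- real k))"
        using C1(1)[of x] that by (intro mult_left_mono) auto
      also have "\<dots> = C1 * x powr (q - 1 - real k)"
        using that by (simp add: powr_diff powr_minus powr_add field_simps)
      also have "\<dots> \<le> C1 * x powr (-2)"
        using that k C1 by (intro mult_left_mono powr_mono) auto
      finally show ?thesis .
    qed
    then show "AE x in lborel. x \<in> {1..} \<longrightarrow> norm (x powr (q - 1) * norm (\<phi> x))
        \<le> norm (C1 * x powr (-2))"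
      using C1 by (auto intro!: AE_I2)
  qed (rule m; auto)
  ultimately have "set_integrable lborel ({0<..1} \<union> {1..}) (\<lambda>x. x powr (q - 1) * norm (\<phi> x))"
    by (rule set_integrable_Un) auto
  then show ?thesis
    by (rule set_integrable_subset) auto
qed

text \<open>Substituting \<open>y = \<epsilon> * x\<close> in the majorant leaves a fixed integral
  times a power of \<epsilon>: \<open>x powr (q - 1)\<close> contributes
  \<open>\<epsilon> powr (1 - q)\<close> and the Jacobian a further
  \<open>1 / \<epsilon>\<close>.\<close>

lemma dilated_schwartz_bound:
  fixes h :: "real \<Rightarrow> complex"
  assumes "q > 0" "\<phi> \<in> schwartz" "continuous_on {0<..} h"
    and h: "\<And>x. x > 0 \<Longrightarrow> norm (h x) \<le> B * x powr (q - 1)" and "\<epsilon> > 0"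
  shows "set_integrable lborel {0<..} (\<lambda>x. h x * \<phi> (\<epsilon> * x))"
    and "norm (LINT x:{0<..}|lborel. h x * \<phi> (\<epsilon> * x)) \<le>
      B * (LINT x:{0<..}|lborel. x powr (q - 1) * norm (\<phi> x)) * \<epsilon> powr (- q)"
proof -
  let ?g = "\<lambda>x. indicator {0<..} x *\<^sub>R (x powr (q - 1) * norm (\<phi> x))"
  have gi: "integrable lborel ?g"
    using set_integrable_powr_schwartz[OF assms(1,2)] by (simp add: set_integrable_def)
  have eq: "indicator {0<..} x *\<^sub>R (B * x powr (q - 1) * norm (\<phi> (\<epsilon> * x)))
      = B * \<epsilon> powr (1 - q) * ?g (0 + \<epsilon> * x)" for x
    using \<open>\<epsilon> > 0\<close> by (auto simp: indicator_def powr_mult powr_diff field_simps zero_less_mult_iff)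
  have bi: "set_integrable lborel {0<..} (\<lambda>x. B * x powr (q - 1) * norm (\<phi> (\<epsilon> * x)))"
    unfolding set_integrable_def eq using \<open>\<epsilon> > 0\<close>
    by (intro integrable_mult_right lborel_integrable_real_affine gi) auto
  have bv: "(LINT x:{0<..}|lborel. B * x powr (q - 1) * norm (\<phi> (\<epsilon> * x))) =
      B * (LINT x:{0<..}|lborel. x powr (q - 1) * norm (\<phi> x)) * \<epsilon> powr (- q)"
    unfolding set_lebesgue_integral_def eq
    unfolding integral_mult_right_zero
    using lborel_integral_real_affine[of \<epsilon> ?g 0] \<open>\<epsilon> > 0\<close>
    by (simp add: powr_diff powr_minus divide_inverse)
  have B: "norm (h x * \<phi> (\<epsilon> * x)) \<le> B * x powr (q - 1) * norm (\<phi> (\<epsilon> * x))" if "x > 0" for x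
    using h[OF that] by (auto simp: norm_mult intro!: mult_right_mono)
  show hi: "set_integrable lborel {0<..} (\<lambda>x. h x * \<phi> (\<epsilon> * x))"
  proof (rule set_integrable_bound[OF bi])
    show "set_borel_measurable lborel {0<..} (\<lambda>x. h x * \<phi> (\<epsilon> * x))"
      unfolding set_borel_measurable_def
      by (auto intro!: borel_measurable_continuous_on_indicator continuous_intros assms(3)
          continuous_on_compose2[OF schwartz_continuous_on[OF assms(2), of UNIV]])
    show "AE x in lborel. x \<in> {0<..} \<longrightarrow> norm (h x * \<phi> (\<epsilon> * x))
        \<le> norm (B * x powr (q - 1) * norm (\<phi> (\<epsilon> * x)))"
      using B by (auto intro!: AE_I2 intro: order_trans[OF _ abs_ge_self])
  qed
  have "norm (LINT x:{0<..}|lborel. h x * \<phi> (\<epsilon> * x))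
      \<le> (LINT x:{0<..}|lborel. norm (h x * \<phi> (\<epsilon> * x)))"
    by (rule set_integral_norm_bound[OF hi])
  also have "\<dots> \<le> (LINT x:{0<..}|lborel. B * x powr (q - 1) * norm (\<phi> (\<epsilon> * x)))"
    using B by (intro set_integral_mono set_integrable_norm hi bi) auto
  finally show "norm (LINT x:{0<..}|lborel. h x * \<phi> (\<epsilon> * x)) \<le>
      B * (LINT x:{0<..}|lborel. x powr (q - 1) * norm (\<phi> x)) * \<epsilon> powr (- q)"
    by (simp add: bv)
qed

text \<open>The gain is the factor \<epsilon> produced by differentiating
  \<open>\<psi> (\<epsilon> * x)\<close>. The boundary term at infinity vanishes because the cutoff
  decays faster than any power.\<close>

lemma dilated_schwartz_parts:
  fixes f F :: "real \<Rightarrow> complex"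
  assumes \<psi>: "\<psi> \<in> schwartz" and "\<epsilon> > 0"
    and F': "\<And>x. x > 0 \<Longrightarrow> (F has_vector_derivative f x) (at x)"
    and f: "continuous_on {0<..} f" "set_integrable lborel {0<..} (\<lambda>x. f x * \<psi> (\<epsilon> * x))"
    and F: "\<And>x. x > 0 \<Longrightarrow> norm (F x) \<le> B * x powr (r - 1)" "r > 0"
    and A: "(F \<longlongrightarrow> A) (at_right 0)"
  shows "(LINT x:{0<..}|lborel. f x * \<psi> (\<epsilon> * x)) =
     - (A * \<psi> 0) - of_real \<epsilon> * (LINT x:{0<..}|lborel. F x * vderiv \<psi> (\<epsilon> * x))"
proof -
  note \<psi>' = schwartz_vderiv[OF \<psi>]
  have cF: "continuous_on {0<..} F"
    by (intro continuous_on_vector_derivative) (use F' in \<open>auto intro: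
        has_vector_derivative_at_within\<close>)
  have iF: "set_integrable lborel {0<..} (\<lambda>x. F x * vderiv \<psi> (\<epsilon> * x))"
    by (rule dilated_schwartz_bound(1)[OF F(2) \<psi>' cF F(1) \<open>\<epsilon> > 0\<close>])
  then have iF': "set_integrable lborel {0<..} (\<lambda>x. of_real \<epsilon> * (F x * vderiv \<psi> (\<epsilon> * x)))"
    by (rule set_integrable_mult_right)
  have "(LINT x:{0<..}|lborel. f x * \<psi> (\<epsilon> * x) + of_real \<epsilon> * (F x * vderiv \<psi> (\<epsilon> * x)))
      = 0 - A * \<psi> 0"
  proof (rule FTC_halfline[where F = "\<lambda>x. F x * \<psi> (\<epsilon> * x)"])
    fix x :: real assume "x > 0"
    have "((\<lambda>x. \<psi> (\<epsilon> * x)) has_vector_derivative \<epsilon> *\<^sub>R vderiv \<psi> (\<epsilon> * x)) (at x)"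
      using vector_diff_chain_at[OF has_vector_derivative_mult_right[OF has_vector_derivative_id,
          of \<epsilon>]
        schwartz_has_vector_derivative[OF \<psi>]]
      by (simp add: o_def del: id_apply)
    from has_vector_derivative_mult[OF F'[OF \<open>x > 0\<close>] this]
    show "((\<lambda>x. F x * \<psi> (\<epsilon> * x)) has_vector_derivative
        f x * \<psi> (\<epsilon> * x) + of_real \<epsilon> * (F x * vderiv \<psi> (\<epsilon> * x))) (at x)"
      by (simp add: scaleR_conv_of_real algebra_simps)
  next
    show "continuous_on {0<..} (\<lambda>x. f x * \<psi> (\<epsilon> * x) + of_real \<epsilon> * (F x * vderiv \<psi> (\<epsilon> * x)))"
      by (intro continuous_intros f cF continuous_on_compose2[OF schwartz_continuous_on[OF \<psi>, of
          UNIV]]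
          continuous_on_compose2[OF schwartz_continuous_on[OF \<psi>', of UNIV]]) auto
    show "set_integrable lborel {0<..} (\<lambda>x. f x * \<psi> (\<epsilon> * x) + of_real \<epsilon> * (F x * vderiv \<psi> (\<epsilon> * x)))"
      by (rule set_integral_add(1)[OF f(2) iF'])
    have "isCont \<psi> 0"
      using schwartz_continuous_on[OF \<psi>, of UNIV] by (simp add: continuous_on_eq_continuous_at)
    then have "((\<lambda>x. \<psi> (\<epsilon> * x)) \<longlongrightarrow> \<psi> 0) (at_right 0)"
      by (rule isCont_tendsto_compose) (auto intro!: tendsto_eq_intros)
    then show "((\<lambda>x. F x * \<psi> (\<epsilon> * x)) \<longlongrightarrow> A * \<psi> 0) (at_right 0)"
      by (intro tendsto_mult A)
  next
    \<comment> \<open>With \<open>k \<ge> r\<close> the boundary term is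
      \<open>O(x powr (- 1))\<close> for fixed \<epsilon>.\<close>
    obtain k :: nat where k: "real k \<ge> r" using real_arch_simple by blast
    obtain C where C: "\<And>x. x > 0 \<Longrightarrow> norm (\<psi> x) \<le> C * x powr (- real k)" "C \<ge> 0"
      using schwartz_decay[OF \<psi>] by blast
    have "B \<ge> 0" using order_trans[OF norm_ge_zero F(1)[of 1]] by simp
    have "norm (F x * \<psi> (\<epsilon> * x)) \<le> B * C * \<epsilon> powr (- real k) * x powr (- 1)" if "x \<ge> 1" for x
    proof -
      have "norm (F x * \<psi> (\<epsilon> * x)) \<le> B * x powr (r - 1) * (C * (\<epsilon> * x) powr (- real k))"
        unfolding norm_mult using that \<open>\<epsilon> > 0\<close> \<open>B \<ge> 0\<close> by (intro mult_mono F C) auto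
      also have "\<dots> = B * C * \<epsilon> powr (- real k) * x powr (r - 1 - real k)"
        using that \<open>\<epsilon> > 0\<close> by (simp add: powr_mult powr_diff powr_minus powr_add field_simps)
      also have "\<dots> \<le> B * C * \<epsilon> powr (- real k) * x powr (- 1)"
        using that k C \<open>B \<ge> 0\<close> by (intro mult_left_mono powr_mono) auto
      finally show ?thesis .
    qed
    then have "eventually (\<lambda>x. norm (F x * \<psi> (\<epsilon> * x))
        \<le> B * C * \<epsilon> powr (- real k) * x powr (- 1)) at_top"
      by (intro eventually_mono[OF eventually_ge_at_top[of 1]])
    moreover have "((\<lambda>x. B * C * \<epsilon> powr (- real k) * x powr (- 1)) \<longlongrightarrow> 0) at_top"
      by (intro tendsto_mult_right_zero tendsto_neg_powr filterlim_ident) auto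
    ultimately show "((\<lambda>x. F x * \<psi> (\<epsilon> * x)) \<longlongrightarrow> 0) at_top"
      by (rule Lim_null_comparison)
  qed
  moreover have "(LINT x:{0<..}|lborel. f x * \<psi> (\<epsilon> * x) + of_real \<epsilon> * (F x * vderiv \<psi> (\<epsilon> * x))) =
     (LINT x:{0<..}|lborel. f x * \<psi> (\<epsilon> * x)) + of_real \<epsilon> * (LINT x:{0<..}|lborel. F x * vderiv \<psi>
         (\<epsilon> * x))"
    using set_integral_add(2)[OF f(2) iF'] by simp
  ultimately show ?thesis by (simp add: algebra_simps add_eq_0_iff)
qed

subsection \<open>Rotation of the path of integration\<close>

lemma Gamma_integral_halfline:
  fixes b :: real
  assumes "b > 0"
  shows "set_integrable lborel {0<..} (\<lambda>u. exp (- u) * u powr (b - 1))"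
    and "(LINT u:{0<..}|lborel. exp (- u) * u powr (b - 1)) = Gamma b"
proof -
  have "((\<lambda>t. t powr (b - 1) / exp t) has_integral Gamma b) {0<..}"
    by (rule has_integral_spike_set_eq[THEN iffD1, OF _ _ Gamma_integral_real[OF assms]])
      (auto intro: negligible_subset[OF negligible_sing[of 0]])
  then have i: "((\<lambda>u. exp (- u) * u powr (b - 1)) has_integral Gamma b) {0<..}"
    by (simp add: exp_minus field_simps)
  then have "(\<lambda>u. exp (- u) * u powr (b - 1)) absolutely_integrable_on {0<..}"
    by (intro nonnegative_absolutely_integrable_1) auto
  then show si: "set_integrable lborel {0<..} (\<lambda>u. exp (- u) * u powr (b - 1))"
    unfolding set_integrable_def by (subst (asm) integrable_completion) auto
  show "(LINT u:{0<..}|lborel. exp (- u) * u powr (b - 1)) = Gamma b"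
    using set_borel_integral_eq_integral(2)[OF si] i by (simp add: integral_unique)
qed

lemma exp_quarter_turn:
  fixes s :: real
  assumes "s = 1 \<or> s = - 1"
  shows "exp (of_real s * \<i> * of_real (pi / 2)) = of_real s * \<i>"
proof -
  have "exp (\<i> * of_real (pi / 2)) = \<i>"
    using cis_conv_exp[of "pi / 2"] by (simp only: cis_pi_half)
  then show ?thesis using assms by (auto simp: exp_minus)
qed

context
  fixes s a :: real
  assumes s: "s = 1 \<or> s = - 1" and a: "0 < a" "a < 1"
begin

text \<open>On the ray \<open>z = t + s * \<i> * u\<close>, \<open>s * s = 1\<close> turns
  \<open>exp (s * \<i> * z)\<close> into \<open>exp (s * \<i> * t) * exp (- u)\<close>. The first
  factor does not depend on \<open>u\<close> and is restored only in
  \<open>rotated_primitive\<close>.\<close>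

abbreviation rotated_integrand :: "real \<Rightarrow> real \<Rightarrow> complex" where
  "rotated_integrand t u \<equiv> of_real (exp (- u)) * Complex t (s * u) powr (of_real a - 1)"

definition rotated_integral :: "real \<Rightarrow> complex" where
  "rotated_integral t = (CLINT u:{0<..}|lborel. rotated_integrand t u)"

text \<open>The integral of \<open>- exp (s \<i> z) z powr (a - 1)\<close> along the ray from \<open>t\<close> in the direction
  \<open>s \<i>\<close>, on which the exponential decays: this is the primitive of the integrand that vanishes
  at infinity.\<close>

definition rotated_primitive :: "real \<Rightarrow> complex" where
  "rotated_primitive t = - (\<i> * of_real s * exp (of_real s * \<i> * of_real t) * rotated_integral t)"

lemma rotated_cmod: "cmod (Complex t (s * u)) = sqrt (t\<^sup>2 + u\<^sup>2)"
  using s by (auto simp: cmod_def)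

text \<open>The point on the ray has modulus at least \<open>u\<close> and at least
  \<open>t\<close>, and the exponent \<open>a - 1\<close> is negative. The first bound is uniform in
  \<open>t\<close>, down to \<open>t = 0\<close>; the second gives decay in \<open>t\<close>. The
  factor \<open>u powr (1 - 1)\<close> matches the integral for \<open>Gamma 1\<close>.\<close>

lemma rotated_integrand_norm:
  assumes "t \<ge> 0" "u > 0"
  shows "norm (rotated_integrand t u) \<le> exp (- u) * u powr (a - 1)"
    and "t > 0 \<Longrightarrow> norm (rotated_integrand t u) \<le> t powr (a - 1) * (exp (- u) * u powr (1 - 1))"
proof -
  have "norm (Complex t (s * u) powr (of_real a - 1)) = (cmod (Complex t (s * u))) powr (a - 1)"
    using norm_powr_real_powr'[of "of_real (a - 1)" "Complex t (s * u)"] by simp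
  also have "\<dots> = sqrt (t\<^sup>2 + u\<^sup>2) powr (a - 1)"
    unfolding rotated_cmod ..
  finally have n: "norm (rotated_integrand t u) = exp (- u) * sqrt (t\<^sup>2 + u\<^sup>2) powr (a - 1)"
    by (simp add: norm_mult)
  show "norm (rotated_integrand t u) \<le> exp (- u) * u powr (a - 1)"
    unfolding n using assms a by (intro mult_left_mono powr_mono2') (auto intro: real_le_rsqrt)
  have "sqrt (t\<^sup>2 + u\<^sup>2) powr (a - 1) \<le> t powr (a - 1)" if "t > 0"
    using that assms a by (intro powr_mono2') (auto intro: real_le_rsqrt)
  then show "norm (rotated_integrand t u) \<le> t powr (a - 1) * (exp (- u) * u powr (1 - 1))"
      if "t > 0"
    unfolding n using that assms by (simp add: mult.commute)
qed

lemma rotated_notin_nonpos_Reals: "t \<ge> 0 \<Longrightarrow> u \<ge> 0 \<Longrightarrow> (t, u) \<noteq> (0, 0) \<Longrightarrow> Complex t (s * u) \<notin> \<real>\<^sub>\<le>\<^sub>0"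
  using s by (auto simp: complex_nonpos_Reals_iff)

lemma rotated_continuous_on:
  assumes "t \<ge> 0"
  shows "continuous_on {0<..} (\<lambda>u. rotated_integrand t u)"
proof -
  have "of_real t + \<i> * of_real (s * u) \<noteq> 0" if "u > 0" for u
    using that s by (auto simp: complex_eq_iff)
  then show ?thesis
    unfolding Complex_eq by (intro continuous_intros continuous_on_powr_complex) (use assms in auto)
qed

lemma rotated_integrable:
  assumes "t \<ge> 0"
  shows "set_integrable lborel {0<..} (\<lambda>u. rotated_integrand t u)"
proof (rule set_integrable_bound[OF Gamma_integral_halfline(1)[OF a(1)]])
  show "set_borel_measurable lborel {0<..} (\<lambda>u. rotated_integrand t u)"
    unfolding set_borel_measurable_def measurable_lborel2
    by (intro borel_measurable_continuous_on_indicator rotated_continuous_on assms) auto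
qed (use rotated_integrand_norm(1)[OF assms] in auto)

text \<open>The factors outside the integral have modulus 1, so the two pointwise bounds can be
  integrated. The constant bound serves near 0, the other one for large \<open>t\<close>.\<close>

lemma norm_rotated_primitive:
  assumes "t > 0"
  shows "norm (rotated_primitive t) \<le> Gamma a" "norm (rotated_primitive t) \<le> t powr (a - 1)"
proof -
  have eq: "norm (rotated_primitive t) = norm (rotated_integral t)"
    using s by (auto simp: rotated_primitive_def norm_mult norm_exp_eq_Re)
  have *: "norm (rotated_integral t) \<le> (LINT u:{0<..}|lborel. norm (rotated_integrand t u))"
    unfolding rotated_integral_def using assms
        by (intro set_integral_norm_bound rotated_integrable) auto
  also have "\<dots> \<le> (LINT u:{0<..}|lborel. exp (- u) * u powr (a - 1))"
    using assms a by (intro set_integral_mono set_integrable_norm rotated_integrable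
        rotated_integrand_norm
      Gamma_integral_halfline) auto
  finally show "norm (rotated_primitive t) \<le> Gamma a"
    using a by (simp add: eq Gamma_integral_halfline)
  note *
  also have "(LINT u:{0<..}|lborel. norm (rotated_integrand t u))
     \<le> (LINT u:{0<..}|lborel. t powr (a - 1) * (exp (- u) * u powr (1 - 1)))"
    using assms a by (intro set_integral_mono set_integrable_norm rotated_integrable
        rotated_integrand_norm
      set_integrable_mult_right Gamma_integral_halfline) auto
  also have "\<dots> = t powr (a - 1)"
    using Gamma_integral_halfline(2)[of 1] by simp
  finally show "norm (rotated_primitive t) \<le> t powr (a - 1)"
    by (simp add: eq)
qed

text \<open>Dominated convergence moves the ray onto the imaginary half-axis, where the power splits
  into the constant phase \<open>?w\<close> and \<open>u powr (a - 1)\<close>, so that the integral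
  becomes \<open>?w * Gamma a\<close>. The prefactor \<open>\<i> * s\<close> is itself a quarter
  turn and raises the phase from \<open>a - 1\<close> to \<open>a\<close>.\<close>

lemma rotated_primitive_at_0:
  "(rotated_primitive \<longlongrightarrow>
      - (exp (of_real s * \<i> * of_real (pi / 2) * of_real a) * Gamma (of_real a))) (at_right 0)"
proof -
  let ?w = "exp (of_real s * \<i> * of_real (pi / 2) * (of_real a - 1)) :: complex"
  have pw: "Complex 0 (s * u) powr (of_real a - 1) = ?w * of_real (u powr (a - 1))" if "u > 0" for u
  proof -
    have "Ln (Complex 0 (s * u)) = of_real (ln u) + of_real s * \<i> * of_real (pi / 2)"
      using Ln_times_of_real[OF that, of "of_real s * \<i>"] s
      by (auto simp: Complex_eq mult_ac Ln_of_real[OF that])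
    moreover have "Complex 0 (s * u) \<noteq> 0"
      using that s by (auto simp: complex_eq_iff)
    ultimately show ?thesis
      using that by (simp add: powr_def exp_of_real[symmetric] mult_exp_exp algebra_simps)
  qed
  have "(rotated_integral \<longlongrightarrow> (CLINT u:{0<..}|lborel. rotated_integrand 0 u)) (at_right 0)"
  proof (rule tendsto_at_right_sequentially[of 0 1])
    fix T :: "nat \<Rightarrow> real"
    assume T: "\<And>n. 0 < T n" "\<And>n. T n < 1" "decseq T" "T \<longlonglongrightarrow> 0"
    show "(\<lambda>n. rotated_integral (T n)) \<longlonglongrightarrow> (CLINT u:{0<..}|lborel. rotated_integrand 0 u)"
      unfolding rotated_integral_def set_lebesgue_integral_def
    proof (rule integral_dominated_convergence)
      show "integrable lborel (\<lambda>u. indicator {0<..} u *\<^sub>R (exp (- u) * u powr (a - 1)))"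
        using Gamma_integral_halfline(1)[OF a(1)] by (simp add: set_integrable_def)
      show "AE u in lborel. norm (indicator {0<..} u *\<^sub>R (rotated_integrand (T n) u))
          \<le> indicator {0<..} u *\<^sub>R (exp (- u) * u powr (a - 1))" for n
        using rotated_integrand_norm(1)[OF less_imp_le[OF T(1)[of n]]]
        by (auto intro!: AE_I2 simp: indicator_def)
      have "(\<lambda>n. rotated_integrand (T n) u) \<longlonglongrightarrow>
          rotated_integrand 0 u" if "u > 0" for u
        using that by (intro tendsto_intros tendsto_powr_complex tendsto_Complex T
            rotated_notin_nonpos_Reals) auto
      then show "AE u in lborel. (\<lambda>n. indicator {0<..} u *\<^sub>R (rotated_integrand (T n) u)) \<longlonglongrightarrow>
          indicator {0<..} u *\<^sub>R (rotated_integrand 0 u)"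
        by (auto intro!: AE_I2 simp: indicator_def)
      show "(\<lambda>u. indicator {0<..} u *\<^sub>R (rotated_integrand (T n) u)) \<in> borel_measurable lborel"
          for n
        using rotated_integrable[OF less_imp_le[OF T(1)[of n]]]
        by (auto simp only: set_integrable_def dest: borel_measurable_integrable)
      show "(\<lambda>u. indicator {0<..} u *\<^sub>R (rotated_integrand 0 u)) \<in> borel_measurable lborel"
        using rotated_integrable[of 0]
        by (auto simp only: set_integrable_def dest: borel_measurable_integrable)
    qed
  qed auto
  also have "(CLINT u:{0<..}|lborel. rotated_integrand 0 u)
      = (CLINT u:{0<..}|lborel. ?w * of_real (exp (- u) * u powr (a - 1)))"
    by (intro set_lebesgue_integral_cong) (auto simp: pw)
  also have "\<dots> = ?w * of_real (Gamma a)"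
    using Gamma_integral_halfline(2)[OF a(1)]
    by (simp only: set_integral_mult_right set_integral_complex_of_real)
  finally have "(rotated_primitive
      \<longlongrightarrow> - (\<i> * of_real s * exp (of_real s * \<i> * of_real 0) * (?w * of_real (Gamma a)))) (at_right
          0)"
    unfolding rotated_primitive_def by (intro tendsto_intros)
  moreover have "exp (of_real s * \<i> * of_real (pi / 2) * of_real a)
      = exp (of_real s * \<i> * of_real (pi / 2)) * ?w"
    by (simp add: exp_add[symmetric] algebra_simps add_divide_distrib diff_divide_distrib)
  then have "exp (of_real s * \<i> * of_real (pi / 2) * of_real a) = (\<i> * of_real s :: complex) * ?w"
    by (simp only: exp_quarter_turn[OF s] mult.commute[of \<i>])
  ultimately show ?thesis
    by (simp add: Gamma_complex_of_real mult_ac)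
qed

text \<open>No differentiation under the integral sign: the integrand extends holomorphically to the
  right half-plane, where it has a primitive \<open>P\<close>, and \<open>rotated_primitive\<close>
  differs from \<open>P\<close> on the positive reals by a constant.\<close>

lemma rotated_primitive_deriv:
  assumes "t > 0"
  shows "(rotated_primitive has_vector_derivative
      exp (of_real s * \<i> * of_real t) * of_real (t powr (a - 1))) (at t)"
proof -
  define f where "f z = exp (of_real s * \<i> * z) * z powr (of_real a - 1)" for z :: complex
  have "f holomorphic_on {z. Re z > 0}"
    unfolding f_def by (intro holomorphic_intros) (auto simp: complex_nonpos_Reals_iff)
  then obtain P where "\<And>z. z \<in> {z. Re z > 0} \<Longrightarrow> (P
      has_field_derivative f z) (at z within {z. Re z > 0})"
    using holomorphic_convex_primitive'[OF convex_halfspace_Re_gt open_halfspace_Re_gt] by blast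
  then have P: "(P has_field_derivative f z) (at z)" if "Re z > 0" for z
    using that by (metis mem_Collect_eq at_within_open open_halfspace_Re_gt)
  have fu: "\<i> * of_real s * f (Complex r (s * u))
      = \<i> * of_real s * exp (of_real s * \<i> * of_real r) *
      rotated_integrand r u" for r u
    using s by (auto simp: f_def Complex_eq algebra_simps exp_add exp_diff exp_minus exp_of_real
        divide_inverse)
  have Pu: "((\<lambda>u. P (Complex r (s * u)))
      has_vector_derivative \<i> * of_real s * f (Complex r (s * u))) (at u)"
    if "r > 0" for r u
  proof -
    have "((\<lambda>u. Complex r (s * u)) has_vector_derivative \<i> * of_real s) (at u)"
      unfolding Complex_eq by (auto intro!: derivative_eq_intros simp: scaleR_conv_of_real)
    from field_vector_diff_chain_at[OF this P] that show ?thesis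
      by (simp add: o_def)
  qed
  \<comment> \<open>Cauchy's theorem for the half-strip between the rays from \<open>r\<close> and
    \<open>t\<close>. Working with the difference of the two rays, no limit of \<open>P\<close>
    along a single ray has to be known.\<close>
  have key: "rotated_primitive t - rotated_primitive r = P (of_real t) - P (of_real r)"
      if "t > 0" "r > 0" for t r
  proof -
    have "(LINT u:{0<..}|lborel. \<i> * of_real s * f (Complex t (s * u)) - \<i> * of_real s * f
        (Complex r (s * u)))
        = 0 - (P (Complex t (s * 0)) - P (Complex r (s * 0)))"
    proof (rule FTC_halfline)
      show "((\<lambda>u. P (Complex t (s * u)) - P (Complex r (s * u))) has_vector_derivative
         \<i> * of_real s * f (Complex t (s * u)) - \<i> * of_real s * f (Complex r (s * u))) (at u)"
             for u
        by (intro has_vector_derivative_diff Pu that)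
      show "continuous_on {0<..} (\<lambda>u. \<i> * of_real s * f (Complex t (s * u)) - \<i> * of_real s * f
          (Complex r (s * u)))"
        unfolding fu using that by (intro continuous_on_diff continuous_on_mult_left
            rotated_continuous_on less_imp_le)
      show "set_integrable lborel {0<..} (\<lambda>u. \<i> * of_real s * f (Complex t (s * u)) - \<i> * of_real
          s * f (Complex r (s * u)))"
        unfolding fu using that by (intro set_integral_diff(1) set_integrable_mult_right
            rotated_integrable less_imp_le)
      have "isCont (\<lambda>u. P (Complex t (s * u)) - P (Complex r (s * u))) 0"
        by (intro continuous_intros has_vector_derivative_continuous[OF Pu] that)
      then show "((\<lambda>u. P (Complex t (s * u)) - P (Complex r (s * u)))
          \<longlongrightarrow> P (Complex t (s * 0)) - P (Complex r (s * 0))) (at_right 0)"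
        by (auto simp: isCont_def intro: tendsto_within_subset)
      \<comment> \<open>\<open>P\<close> is compared along the horizontal line at height
        \<open>s * u\<close>, where its derivative is at most \<open>exp (- u)\<close>;
        \<open>u \<ge> 1\<close> gives \<open>u powr (a - 1) \<le> 1\<close>.\<close>
      have "norm (P (Complex t (s * u)) - P (Complex r (s * u)))
          \<le> exp (- u) * norm (Complex t (s * u) - Complex r (s * u))"
        if "u \<ge> 1" for u
      proof (rule field_differentiable_bound)
        show "convex ({z. Re z > 0} \<inter> {z. Im z = s * u})"
          by (intro convex_Int convex_halfspace_Re_gt) (auto simp: convex_def algebra_simps simp
              flip: distrib_right)
        fix z assume z: "z \<in> {z. Re z > 0} \<inter> {z. Im z = s * u}"
        then have zz: "z = Complex (Re z) (s * u)" by (simp add: complex_eq_iff)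
        show "(P has_field_derivative f z) (at z within {z. Re z > 0} \<inter> {z. Im z = s * u})"
          using z by (auto intro: has_field_derivative_at_within P)
        have "norm (f z) = norm (\<i> * of_real s * f z)"
          using s by (auto simp: norm_mult)
        also have "\<dots> = norm (rotated_integrand (Re z) u)"
          by (subst zz, subst fu) (use s in \<open>auto simp: norm_mult norm_exp_eq_Re\<close>)
        also have "\<dots> \<le> exp (- u) * u powr (a - 1)"
          using z that by (intro rotated_integrand_norm) auto
        also have "\<dots> \<le> exp (- u) * 1"
          using that a powr_mono2'[of "a - 1" 1 u] by (intro mult_left_mono) auto
        finally show "norm (f z) \<le> exp (- u)" by simp
      qed (use that \<open>t > 0\<close> \<open>r > 0\<close> in auto)
      moreover have "norm (Complex t (s * u) - Complex r (s * u)) = \<bar>t - r\<bar>" for u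
        by (simp add: cmod_def)
      ultimately have "eventually (\<lambda>u. norm (P (Complex t (s * u)) - P (Complex r (s * u)))
          \<le> exp (- u) * \<bar>t - r\<bar>) at_top"
        by (intro eventually_mono[OF eventually_ge_at_top[of 1]]) auto
      moreover have "((\<lambda>u. exp (- u) * \<bar>t - r\<bar>) \<longlongrightarrow> 0) at_top"
        by (intro tendsto_mult_left_zero filterlim_compose[OF exp_at_bot]
            filterlim_uminus_at_bot_at_top)
      ultimately show "((\<lambda>u. P (Complex t (s * u)) - P (Complex r (s * u))) \<longlongrightarrow> 0) at_top"
        by (rule Lim_null_comparison)
    qed
    moreover have "(LINT u:{0<..}|lborel. \<i> * of_real s * f (Complex t (s * u)) - \<i> * of_real s *
        f (Complex r (s * u)))
        = - rotated_primitive t + rotated_primitive r"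
      unfolding fu rotated_primitive_def rotated_integral_def
      using that by (subst set_integral_diff) (auto intro!: rotated_integrable)
    ultimately have "- rotated_primitive t + rotated_primitive r
        = 0 - (P (Complex t (s * 0)) - P (Complex r (s * 0)))"
      by (simp only:)
    then show ?thesis
      by (simp add: Complex_eq algebra_simps)
  qed
  have "((\<lambda>t. P (of_real t) + (rotated_primitive t0 - P (of_real t0))) has_vector_derivative
      exp (of_real s * \<i> * of_real t) * of_real (t powr (a - 1))) (at t)" for t0
  proof -
    have "((\<lambda>t. P (of_real t)) has_vector_derivative f (of_real t)) (at t)"
      using has_vector_derivative_real_field[OF P] assms by simp
    moreover have "f (of_real t) = exp (of_real s * \<i> * of_real t) * of_real (t powr (a - 1))"
      using assms powr_of_real[of t "a - 1"] by (simp add: f_def)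
    ultimately show ?thesis
      by (simp add: has_vector_derivative_add_const)
  qed
  then show ?thesis
  proof (rule has_vector_derivative_transform_within_open)
    show "P (of_real x) + (rotated_primitive 1 - P (of_real 1)) = rotated_primitive x"
        if "x \<in> {0<..}" for x
      using key[of x 1] that by (simp add: algebra_simps)
  qed (use assms in auto)
qed

end

subsection \<open>The closed form and its poles\<close>

lemma isolated_zero_simple:
  fixes g :: "complex \<Rightarrow> complex"
  assumes "g analytic_on {z}" "g z = 0" "deriv g z \<noteq> 0"
  shows "isolated_zero g z"
proof (rule ccontr)
  assume "\<not> isolated_zero g z"
  then have "eventually (\<lambda>w. g w = 0) (nhds z)"
    using non_isolated_zero_imp_eventually_zero'[of g z] assms by auto
  then have "deriv g z = deriv (\<lambda>_. 0) z"
    by (intro deriv_cong_ev) auto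
  then show False using assms(3) by simp
qed

text \<open>The derivative condition is imposed only at a zero, so that the equivalence can be used
  at every point; away from the zeros continuity of \<open>g\<close> rules out a pole.\<close>

lemma inverse_simple_zero_pole:
  fixes g :: "complex \<Rightarrow> complex"
  assumes "g analytic_on {z}" "g z = 0 \<Longrightarrow> deriv g z \<noteq> 0"
  shows is_pole_inverse_simple_zero: "is_pole (\<lambda>w. inverse (g w)) z \<longleftrightarrow> g z = 0"
    and zorder_inverse_simple_zero: "g z = 0 \<Longrightarrow> zorder (\<lambda>w. inverse (g w)) z = - 1"
proof -
  show "is_pole (\<lambda>w. inverse (g w)) z \<longleftrightarrow> g z = 0"
    using isolated_zero_simple[of g z] assms zero_isolated_zero[of g z] analytic_at_imp_isCont[of
        g z]
    by (auto simp: is_pole_inverse_iff)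
  assume 0: "g z = 0"
  then have iz: "isolated_zero g z" using isolated_zero_simple assms by blast
  have "zorder g z = 1"
    using assms 0 by (intro zorder_zero_eqI') auto
  moreover have "zorder (\<lambda>w. inverse (g w)) z = - zorder g z"
  proof (rule zorder_inverse)
    show "isolated_singularity_at g z"
      by (intro isolated_singularity_at_analytic assms)
    show "not_essential g z"
      by (intro not_essential_analytic assms)
    show "\<exists>\<^sub>F w in at z. g w \<noteq> 0"
      using iz by (auto simp: isolated_zero_def intro!: eventually_frequently)
  qed
  ultimately show "zorder (\<lambda>w. inverse (g w)) z = - 1" by simp
qed

definition fresnel :: "real \<Rightarrow> complex \<Rightarrow> complex \<Rightarrow> complex" where
  "fresnel s p q = inverse p * exp (of_real s * \<i> * of_real (pi / 2) * (q / p)) * Gamma (q / p)"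

text \<open>The zeros of this analytic function are simple, except that for \<open>q = 0\<close> it vanishes identically
  in \<open>p\<close>. At its zeros \<^const>\<open>inverse\<close> and \<^const>\<open>Gamma\<close> both have the junk value \<open>0\<close>.\<close>

definition recip_fresnel :: "real \<Rightarrow> complex \<Rightarrow> complex \<Rightarrow> complex" where
  "recip_fresnel s p q = p * exp (- (of_real s * \<i> * of_real (pi / 2) * (q / p))) * rGamma (q / p)"

text \<open>Holds without exception, since both sides take the default value 0 at the poles of
  \<open>Gamma\<close> and at \<open>p = 0\<close>. Questions about poles thus become questions
  about zeros of an expression in the entire function \<open>rGamma\<close>.\<close>

lemma fresnel_eq_inverse: "fresnel s p q = inverse (recip_fresnel s p q)"
  by (simp add: fresnel_def recip_fresnel_def rGamma_inverse_Gamma exp_minus inverse_mult_distrib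
      mult_ac)

lemma recip_fresnel_eq_0_iff:
  "p \<noteq> 0 \<Longrightarrow> recip_fresnel s p q = 0 \<longleftrightarrow> (\<exists>j::nat. q = - p * of_nat j)"
  by (auto simp: recip_fresnel_def rGamma_eq_zero_iff field_simps elim!: nonpos_Ints_cases')

lemma analytic_recip_fresnel:
  "p \<noteq> 0 \<Longrightarrow> (\<lambda>q. recip_fresnel s p q) analytic_on A"
  "0 \<notin> B \<Longrightarrow> (\<lambda>p. recip_fresnel s p q) analytic_on B"
  unfolding recip_fresnel_def by (auto intro!: analytic_intros)

text \<open>At a zero of \<open>rGamma (q / p)\<close> the product rule keeps only the term with the
  derivative of \<open>rGamma\<close>, which at \<open>- j\<close> is
  \<open>(-1)^j * fact j\<close>. The inner derivative is \<open>1 / p\<close> in \<open>q\<close>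
  and \<open>- q / (p * p)\<close> in \<open>p\<close>; the latter is nonzero only for
  \<open>q \<noteq> 0\<close>.\<close>

lemma deriv_recip_fresnel_nonzero:
  assumes "p \<noteq> 0" "recip_fresnel s p q = 0"
  shows "deriv (\<lambda>q. recip_fresnel s p q) q \<noteq> 0"
    and "q \<noteq> 0 \<Longrightarrow> deriv (\<lambda>p. recip_fresnel s p q) p \<noteq> 0"
proof -
  obtain j :: nat where j: "q / p = - of_nat j"
    using assms by (auto simp: recip_fresnel_eq_0_iff)
  have r: "(rGamma has_field_derivative (-1)^j * fact j) (at (q / p))"
    unfolding j by (rule has_field_derivative_rGamma_nonpos_int)
  have r0: "rGamma (q / p) = 0"
    using assms by (auto simp: recip_fresnel_def)
  have "((\<lambda>q. rGamma (q / p)) has_field_derivative (-1)^j * fact j * (1 / p)) (at q)"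
    using assms by (intro DERIV_chain2[where f = rGamma and g = "\<lambda>q. q / p", OF r])
      (auto intro!: derivative_eq_intros)
  note dG = this
  \<comment> \<open>Only existence of this derivative matters: its value \<open>D\<close> gets
    multiplied by \<open>rGamma (q / p) = 0\<close>.\<close>
  have "(\<lambda>q. p * exp (- (of_real s * \<i> * of_real (pi / 2) * (q / p)))) field_differentiable at q"
    using assms by (intro analytic_on_imp_differentiable_at[of _ "{q}"] analytic_intros) auto
  then obtain D where "((\<lambda>q. p * exp (- (of_real s * \<i> * of_real (pi / 2) * (q / p))))
      has_field_derivative D) (at q)"
    unfolding field_differentiable_def by blast
  from DERIV_mult[OF this dG] have "((\<lambda>q. recip_fresnel s p q) has_field_derivative
     p * exp (- (of_real s * \<i> * of_real (pi / 2) * (q / p))) * ((-1)^j * fact j * (1 / p))) (at q)"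
    by (simp add: recip_fresnel_def r0 mult_ac)
  then show "deriv (\<lambda>q. recip_fresnel s p q) q \<noteq> 0"
    using assms by (auto dest!: DERIV_imp_deriv)
  assume "q \<noteq> 0"
  have "((\<lambda>p. rGamma (q / p)) has_field_derivative (-1)^j * fact j * (- q / (p * p))) (at p)"
    using assms by (intro DERIV_chain2[where f = rGamma and g = "\<lambda>p. q / p", OF r])
      (auto intro!: derivative_eq_intros)
  note dG = this
  have "(\<lambda>p. p * exp (- (of_real s * \<i> * of_real (pi / 2) * (q / p)))) field_differentiable at p"
    using assms by (intro analytic_on_imp_differentiable_at[of _ "{p}"] analytic_intros) auto
  then obtain D where "((\<lambda>p. p * exp (- (of_real s * \<i> * of_real (pi / 2) * (q / p))))
      has_field_derivative D) (at p)"
    unfolding field_differentiable_def by blast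
  from DERIV_mult[OF this dG] have "((\<lambda>p. recip_fresnel s p q) has_field_derivative
     p * exp (- (of_real s * \<i> * of_real (pi / 2) * (q / p))) * ((-1)^j * fact j * (- q / (p *
         p)))) (at p)"
    by (simp add: recip_fresnel_def r0 mult_ac)
  then show "deriv (\<lambda>p. recip_fresnel s p q) p \<noteq> 0"
    using assms \<open>q \<noteq> 0\<close> by (auto dest!: DERIV_imp_deriv)
qed

text \<open>\<open>inverse\<close> sends zeros to 0, the value that
  \<open>nicely_meromorphic_on\<close> prescribes at poles.\<close>

lemma fresnel_nicely_meromorphic:
  "p \<noteq> 0 \<Longrightarrow> (\<lambda>q. fresnel s p q) nicely_meromorphic_on UNIV"
  "(\<lambda>p. fresnel s p q) nicely_meromorphic_on - {0}"
  unfolding fresnel_eq_inverse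
  by (intro nicely_meromorphic_on_inverse analytic_on_imp_nicely_meromorphic_on
      analytic_recip_fresnel; simp)+

lemma fresnel_pole_q:
  assumes "p \<noteq> 0"
  shows "is_pole (\<lambda>q. fresnel s p q) q \<longleftrightarrow> (\<exists>j::nat. q = - p * of_nat j)"
    and "is_pole (\<lambda>q. fresnel s p q) q \<Longrightarrow> zorder (\<lambda>q. fresnel s p q) q = - 1"
    and "\<not> is_pole (\<lambda>q. fresnel s p q) q \<Longrightarrow> fresnel s p q \<noteq> 0"
  using inverse_simple_zero_pole[of "\<lambda>q. recip_fresnel s p q" q]
    analytic_recip_fresnel(1)[of p s "{q}"] deriv_recip_fresnel_nonzero(1)[of p s q]
    recip_fresnel_eq_0_iff[of p s q] assms
  unfolding fresnel_eq_inverse by auto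

text \<open>For \<open>q = 0\<close> the quotient \<open>q / p\<close> sits at a pole of
  \<open>Gamma\<close> for every \<open>p\<close>, so the function is identically 0 by default
  values and has no poles.\<close>

lemma fresnel_pole_p:
  assumes "p \<noteq> 0"
  shows "is_pole (\<lambda>p. fresnel s p q) p \<longleftrightarrow> q \<noteq> 0 \<and> (\<exists>j::nat. q = - p * of_nat j)"
    and "is_pole (\<lambda>p. fresnel s p q) p \<Longrightarrow> zorder (\<lambda>p. fresnel s p q) p = - 1"
proof -
  have "\<not> is_pole (\<lambda>p. fresnel s p 0) p"
    by (simp add: fresnel_def)
  then show "is_pole (\<lambda>p. fresnel s p q) p \<longleftrightarrow> q \<noteq> 0 \<and> (\<exists>j::nat. q = - p * of_nat j)"
    and "is_pole (\<lambda>p. fresnel s p q) p \<Longrightarrow> zorder (\<lambda>p. fresnel s p q) p = - 1"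
    using inverse_simple_zero_pole[of "\<lambda>p. recip_fresnel s p q" p]
      analytic_recip_fresnel(2)[of "{p}" s q] deriv_recip_fresnel_nonzero(2)[of p s q]
      recip_fresnel_eq_0_iff[of p s q] assms
    by (cases "q = 0"; auto simp: fresnel_eq_inverse)+
qed

lemma of_real_fresnel:
  "fresnel s (of_real p) (of_real q) = inverse (of_real p) *
     exp (of_real s * \<i> * of_real (pi / 2) * of_real (q / p)) * Gamma (of_real (q / p))"
  by (simp add: fresnel_def)

subsection \<open>The regularised integrals\<close>

lemma powr_tendsto_0_at_right:
  assumes "d > 0"
  shows "((\<lambda>x. C * x powr d) \<longlongrightarrow> 0) (at_right (0::real))"
proof -
  have "((\<lambda>x::real. x powr d) \<longlongrightarrow> 0 powr d) (at_right 0)"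
    using assms by (intro tendsto_powr') (auto simp: eventually_at_right_less intro!:
        tendsto_eq_intros eventually_mono[OF eventually_at_right_less[of 0]])
  then show ?thesis
    using assms by (intro tendsto_mult_right_zero) simp
qed

lemma Lim_null_powr_at_right:
  fixes f :: "real \<Rightarrow> complex"
  assumes "d > 0" "\<And>x. x > 0 \<Longrightarrow> norm (f x) \<le> C * x powr d"
  shows "(f \<longlongrightarrow> 0) (at_right 0)"
  by (rule Lim_null_comparison[OF _ powr_tendsto_0_at_right[OF assms(1), of C]])
    (use assms in \<open>auto intro!: eventually_mono[OF eventually_at_right_less[of 0]]\<close>)

definition osc_integral :: "real \<Rightarrow> real \<Rightarrow> real \<Rightarrow> (real \<Rightarrow> complex) \<Rightarrow> real \<Rightarrow> complex" where
  "osc_integral s p q \<psi> \<epsilon> = (CLINT x:{0<..}|lborel. fresnel_integrand s p q x * \<psi> (\<epsilon> * x))"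

lemma norm_fresnel_integrand: "norm (fresnel_integrand s p q x) = x powr (q - 1)"
  by (simp add: fresnel_integrand_def norm_mult norm_exp_eq_Re)

lemma fresnel_integrand_Suc:
  "x > 0 \<Longrightarrow> fresnel_integrand s p (q + 1) x = of_real x * fresnel_integrand s p q x"
  by (simp add: fresnel_integrand_def powr_diff)

text \<open>The exponent \<open>q + 1\<close> stands for the factor \<open>x powr q\<close>. The two
  terms of the product rule have exponents \<open>q\<close> and \<open>q + p\<close>, which is where
  the shift by \<open>p\<close> in the functional equation comes from.\<close>

lemma fresnel_integrand_has_vector_derivative:
  assumes "x > 0"
  shows "(fresnel_integrand s p (q + 1) has_vector_derivative
     of_real q * fresnel_integrand s p q x +
     of_real s * \<i> * of_real p * fresnel_integrand s p (q + p) x) (at x)"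
proof -
  have p: "((\<lambda>x. of_real (x powr r) :: complex)
      has_vector_derivative of_real (r * x powr (r - 1))) (at x)" for r
    using has_real_derivative_powr[OF assms, of r]
    by (intro has_vector_derivative_of_real) (simp add:
        has_real_derivative_iff_has_vector_derivative)
  have "((\<lambda>x. of_real s * \<i> * of_real (x powr p))
      has_vector_derivative of_real s * \<i> * of_real (p * x powr (p - 1))) (at x)"
    by (intro has_vector_derivative_mult_right p)
  from field_vector_diff_chain_at[OF this DERIV_exp]
  have "((\<lambda>x. exp (of_real s * \<i> * of_real (x powr p))) has_vector_derivative
     of_real s * \<i> * of_real (p * x powr (p - 1)) * exp (of_real s * \<i> * of_real (x powr p))) (at
         x)"
    by (simp add: o_def)
  from has_vector_derivative_mult[OF this p[of q]]
  have "((\<lambda>x. exp (of_real s * \<i> * of_real (x powr p)) * of_real (x powr q)) has_vector_derivative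
     exp (of_real s * \<i> * of_real (x powr p)) * of_real (q * x powr (q - 1)) +
     of_real s * \<i> * of_real (p * x powr (p - 1)) * exp (of_real s * \<i> * of_real (x powr p)) *
         of_real (x powr q)) (at x)" .
  moreover have "x powr (q + p - 1) = x powr (p - 1) * x powr q"
    by (simp add: powr_add[symmetric] algebra_simps)
  ultimately show ?thesis
    by (simp add: fresnel_integrand_def[abs_def] algebra_simps)
qed

lemma continuous_on_fresnel_integrand: "continuous_on {0<..} (fresnel_integrand s p q)"
  unfolding fresnel_integrand_def[abs_def] by (intro continuous_intros) auto

lemma osc_integrable:
  assumes "q > 0" "\<psi> \<in> schwartz" "\<epsilon> > 0"
  shows "set_integrable lborel {0<..} (\<lambda>x. fresnel_integrand s p q x * \<psi> (\<epsilon> * x))"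
  by (rule dilated_schwartz_bound(1)[OF assms(1,2) continuous_on_fresnel_integrand _ assms(3), of
      _ _ _ 1])
    (simp add: norm_fresnel_integrand)

lemma osc_integral_bound:
  assumes "q > 0" "\<psi> \<in> schwartz"
  obtains C where "\<And>\<epsilon>. \<epsilon> > 0 \<Longrightarrow> norm (osc_integral s p q \<psi> \<epsilon>) \<le> C * \<epsilon> powr (- q)"
  using dilated_schwartz_bound(2)[OF assms continuous_on_fresnel_integrand, of s p q 1]
  by (auto simp: norm_fresnel_integrand osc_integral_def)

text \<open>Raising the exponent by 1 supplies a factor \<open>x\<close>, which together with
  \<epsilon> forms the argument of the dilated cutoff.\<close>

lemma osc_integral_scaleR_id:
  "\<epsilon> > 0 \<Longrightarrow> of_real \<epsilon> * osc_integral s p (q + 1) \<phi> \<epsilon> = osc_integral s p q (\<lambda>x. x *\<^sub>R \<phi> x) \<epsilon>"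
  unfolding osc_integral_def set_integral_mult_right[symmetric]
  by (intro set_lebesgue_integral_cong) (auto simp: fresnel_integrand_Suc scaleR_conv_of_real)

text \<open>For \<open>q = 0\<close> the first integral on the right need not converge, but it is multiplied by \<open>0\<close>.\<close>

lemma osc_integral_parts:
  assumes "p > 0" "q \<ge> 0" "\<psi> \<in> schwartz" "\<epsilon> > 0"
  shows "of_real s * \<i> * of_real p * osc_integral s p (q + p) \<psi> \<epsilon> =
     - (if q = 0 then \<psi> 0 else 0) - of_real q * osc_integral s p q \<psi> \<epsilon>
     - of_real \<epsilon> * osc_integral s p (q + 1) (vderiv \<psi>) \<epsilon>"
proof -
  let ?f = "\<lambda>x. of_real q * fresnel_integrand s p q x + of_real s * \<i> * of_real p *
      fresnel_integrand s p (q + p) x"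
  have i1: "set_integrable lborel {0<..} (\<lambda>x. of_real q * (fresnel_integrand s p q x * \<psi> (\<epsilon> * x)))"
  proof (cases "q = 0")
    case False
    then show ?thesis
      using assms by (intro set_integrable_mult_right osc_integrable) auto
  qed (simp add: set_integrable_def)
  have i2: "set_integrable lborel {0<..} (\<lambda>x. of_real s * \<i> * of_real p * (fresnel_integrand s p
      (q + p) x * \<psi> (\<epsilon> * x)))"
    using assms by (intro set_integrable_mult_right osc_integrable) auto
  have f: "?f x * \<psi> (\<epsilon> * x) = of_real q * (fresnel_integrand s p q x * \<psi> (\<epsilon> * x)) +
       of_real s * \<i> * of_real p * (fresnel_integrand s p (q + p) x * \<psi> (\<epsilon> * x))" for x
    by (simp add: algebra_simps)
  \<comment> \<open>Here \<open>r = q + 1\<close> because the primitive has modulus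
    \<open>x powr q\<close>. Its limit at 0 is 0 unless \<open>q = 0\<close>, when it is 1.\<close>
  have "(LINT x:{0<..}|lborel. ?f x * \<psi> (\<epsilon> * x)) = - ((if q = 0 then 1 else 0) * \<psi> 0) -
     of_real \<epsilon> * (LINT x:{0<..}|lborel. fresnel_integrand s p (q + 1) x * vderiv \<psi> (\<epsilon> * x))"
  proof (rule dilated_schwartz_parts[where B = 1 and r = "q + 1"])
    show "set_integrable lborel {0<..} (\<lambda>x. ?f x * \<psi> (\<epsilon> * x))"
      unfolding f by (rule set_integral_add(1)[OF i1 i2])
    show "(fresnel_integrand s p (q + 1) \<longlongrightarrow> (if q = 0 then 1 else 0)) (at_right 0)"
    proof (cases "q = 0")
      case True
      have "((\<lambda>x. exp (of_real s * \<i> * of_real (1 * x powr p)))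
          \<longlongrightarrow> exp (of_real s * \<i> * of_real 0)) (at_right 0)"
        by (intro tendsto_intros powr_tendsto_0_at_right assms)
      then show ?thesis
        using True by (auto elim!: Lim_transform_eventually simp: fresnel_integrand_def
          intro!: eventually_mono[OF eventually_at_right_less[of 0]])
    next
      case False
      then have "(fresnel_integrand s p (q + 1) \<longlongrightarrow> 0) (at_right 0)"
        using assms by (intro Lim_null_powr_at_right[of q _ 1]) (auto simp: norm_fresnel_integrand)
      then show ?thesis using False by simp
    qed
    show "continuous_on {0<..} ?f"
      by (intro continuous_intros continuous_on_fresnel_integrand)
  qed (use assms in \<open>auto simp: norm_fresnel_integrand fresnel_integrand_has_vector_derivative\<close>)
  moreover have "(LINT x:{0<..}|lborel. ?f x * \<psi> (\<epsilon> * x)) =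
      of_real q * osc_integral s p q \<psi> \<epsilon> + of_real s * \<i> * of_real p * osc_integral s p (q + p) \<psi> \<epsilon>"
    unfolding f set_integral_add(2)[OF i1 i2] set_integral_mult_right osc_integral_def ..
  ultimately show ?thesis
    by (simp add: osc_integral_def algebra_simps)
qed

section \<open>Limits of the regularised integrals\<close>

context
  fixes s p :: real
  assumes s: "s = 1 \<or> s = - 1" and p: "p > 0"
begin

text \<open>Inserting \<open>x powr p\<close> into the rotated primitive with
  \<open>a = q / p\<close> gives a primitive of the integrand; \<open>q < p\<close> ensures
  \<open>a < 1\<close>. It vanishes at infinity, so its limit at 0 is minus the value sought, and
  integration by parts restores the sign.\<close>

lemma osc_integral_tendsto_less:
  assumes "0 < q" "q < p" and \<psi>: "\<psi> \<in> schwartz"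
  shows "(osc_integral s p q \<psi> \<longlongrightarrow> fresnel s (of_real p) (of_real q) * \<psi> 0) (at_right 0)"
proof -
  define a where "a = q / p"
  have a: "0 < a" "a < 1" using assms p by (auto simp: a_def)
  define F where "F x = rotated_primitive s a (x powr p) / of_real p" for x
  \<comment> \<open>\<open>d \<le> p - q\<close> weakens the decay at infinity to
    \<open>x powr (- d)\<close>, which near 0 dominates a bounded function; \<open>d < 1\<close>
    keeps \<open>r = 1 - d\<close> positive. With the extra factor \<epsilon> the remainder is
    \<open>O(\<epsilon> powr d)\<close>.\<close>
  define d where "d = min (p - q) (1 / 2)"
  have d: "0 < d" "d < 1" "d \<le> p - q" using assms by (auto simp: d_def)
  define B where "B = max (Gamma a) 1 / p"
  have F': "(F has_vector_derivative fresnel_integrand s p q x) (at x)" if "x > 0" for x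
  proof -
    have "((\<lambda>x. x powr p) has_vector_derivative p * x powr (p - 1)) (at x)"
      using has_real_derivative_powr[OF that, of p]
          by (simp add: has_real_derivative_iff_has_vector_derivative)
    from vector_diff_chain_at[OF this rotated_primitive_deriv[OF s a]] that
    have "((\<lambda>x. rotated_primitive s a (x powr p)) has_vector_derivative
        (p * x powr (p - 1)) *\<^sub>R (exp (of_real s * \<i> * of_real (x powr p)) * of_real ((x powr p)
            powr (a - 1)))) (at x)"
      by (simp add: o_def)
    from has_vector_derivative_mult_right[OF this, of "1 / of_real p"]
    have "(F has_vector_derivative 1 / of_real p * ((p * x powr (p - 1)) *\<^sub>R (exp (of_real s * \<i> *
        of_real (x powr p)) * of_real ((x powr p) powr (a - 1))))) (at x)"
      by (simp add: F_def[abs_def])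
    moreover have "x powr (p - 1) * (x powr p) powr (a - 1) = x powr (q - 1)"
      using p by (simp add: powr_powr powr_add[symmetric] a_def algebra_simps)
    moreover have "1 / of_real p * ((p * x powr (p - 1)) *\<^sub>R (exp (of_real s * \<i> * of_real (x powr
        p)) * of_real ((x powr p) powr (a - 1)))) =
        exp (of_real s * \<i> * of_real (x powr p)) * of_real (x powr (p - 1) * (x powr p) powr (a -
            1))"
      using p by (simp add: scaleR_conv_of_real)
    ultimately show ?thesis by (simp only: fresnel_integrand_def)
  qed
  have Fb: "norm (F x) \<le> B * x powr ((1 - d) - 1)" if "x > 0" for x
  proof -
    have xp: "x powr p > 0" using that by simp
    have "norm (rotated_primitive s a (x powr p)) \<le> max (Gamma a) 1 * x powr (- d)"
    proof (cases "x \<le> 1")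
      case True
      have "norm (rotated_primitive s a (x powr p)) \<le> max (Gamma a) 1 * 1"
        using norm_rotated_primitive(1)[OF s a xp] by simp
      also have "\<dots> \<le> max (Gamma a) 1 * x powr (- d)"
        using powr_mono2'[of "- d" x 1] True that d by (intro mult_left_mono) auto
      finally show ?thesis .
    next
      case False
      have "norm (rotated_primitive s a (x powr p)) \<le> (x powr p) powr (a - 1)"
        by (rule norm_rotated_primitive(2)[OF s a xp])
      also have "\<dots> = 1 * x powr (q - p)"
        using p by (simp add: powr_powr a_def algebra_simps)
      also have "\<dots> \<le> max (Gamma a) 1 * x powr (- d)"
        using False d by (intro mult_mono powr_mono) auto
      finally show ?thesis .
    qed
    then show ?thesis
      using p by (simp add: F_def B_def norm_divide divide_right_mono)
  qed
  have F0: "(F \<longlongrightarrow> - fresnel s (of_real p) (of_real q)) (at_right 0)"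
  proof -
    have "filterlim (\<lambda>x. x powr p) (at_right 0) (at_right 0)"
      using powr_tendsto_0_at_right[OF p, of 1]
      by (auto simp: filterlim_at intro!: eventually_mono[OF eventually_at_right_less[of 0]])
    from filterlim_compose[OF rotated_primitive_at_0[OF s a] this]
    have "(F \<longlongrightarrow> - (exp (of_real s * \<i> * of_real (pi / 2) * of_real a) * Gamma (of_real a)) /
        of_real p) (at_right 0)"
      unfolding F_def[abs_def] using p by (intro tendsto_intros) auto
    then show ?thesis by (simp add: of_real_fresnel a_def field_simps)
  qed
  have cF: "continuous_on {0<..} F"
    by (rule continuous_on_vector_derivative) (use F' in \<open>auto intro:
        has_vector_derivative_at_within\<close>)
  define R where "R \<epsilon> = (LINT x:{0<..}|lborel. F x * vderiv \<psi> (\<epsilon> * x))" for \<epsilon>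
  obtain C where C: "\<And>\<epsilon>. \<epsilon> > 0 \<Longrightarrow> norm (R \<epsilon>) \<le> C * \<epsilon> powr (- (1 - d))"
    using dilated_schwartz_bound(2)[OF _ schwartz_vderiv[OF \<psi>] cF Fb] d unfolding R_def by auto
  have "((\<lambda>\<epsilon>. of_real \<epsilon> * R \<epsilon>) \<longlongrightarrow> 0) (at_right 0)"
  proof (rule Lim_null_powr_at_right[OF d(1)])
    fix \<epsilon> :: real assume "\<epsilon> > 0"
    then have "norm (of_real \<epsilon> * R \<epsilon>) \<le> \<epsilon> * (C * \<epsilon> powr (- (1 - d)))"
      unfolding norm_mult using C by (intro mult_mono) auto
    also have "\<dots> = C * \<epsilon> powr d"
      using \<open>\<epsilon> > 0\<close> by (simp add: powr_diff)
    finally show "norm (of_real \<epsilon> * R \<epsilon>) \<le> C * \<epsilon> powr d" .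
  qed
  then have "((\<lambda>\<epsilon>. fresnel s (of_real p) (of_real q) * \<psi> 0 - of_real \<epsilon> * R \<epsilon>) \<longlongrightarrow>
      fresnel s (of_real p) (of_real q) * \<psi> 0 - 0) (at_right 0)"
    by (intro tendsto_intros)
  moreover have "osc_integral s p q \<psi> \<epsilon>
      = fresnel s (of_real p) (of_real q) * \<psi> 0 - of_real \<epsilon> * R \<epsilon>" if "\<epsilon> > 0" for \<epsilon>
    using dilated_schwartz_parts[OF \<psi> that F' continuous_on_fresnel_integrand osc_integrable[OF
        assms(1) \<psi> that] Fb _ F0] d
    by (simp add: osc_integral_def R_def)
  ultimately show ?thesis
    by (auto elim!: Lim_transform_eventually intro!: eventually_mono[OF
        eventually_at_right_less[of 0]])
qed

text \<open>A Riemann--Lebesgue statement: with \<open>y = \<epsilon> x\<close> the phase becomes \<open>s (y / \<epsilon>) powr p\<close>.\<close>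

lemma osc_integral_1_tendsto:
  assumes \<phi>: "\<phi> \<in> schwartz"
  shows "((\<lambda>\<epsilon>. of_real \<epsilon> * osc_integral s p 1 \<phi> \<epsilon>) \<longlongrightarrow> 0) (at_right 0)"
proof (cases "p > 1")
  case True
  have "((\<lambda>\<epsilon>. of_real \<epsilon> * osc_integral s p 1 \<phi> \<epsilon>)
      \<longlongrightarrow> of_real 0 * (fresnel s (of_real p) (of_real 1) * \<phi> 0)) (at_right 0)"
    using True \<phi> by (intro tendsto_mult tendsto_of_real osc_integral_tendsto_less) (auto intro:
        tendsto_eq_intros)
  then show ?thesis by simp
next
  case False
  \<comment> \<open>The left side of \<open>osc_integral_parts\<close> then has exponent 1. After
    multiplication by \<epsilon> both integrals on the right are \<open>O(\<epsilon> powr p)\<close>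
    by \<open>osc_integral_bound\<close>, which ignores oscillation; the boundary term, present only
    for \<open>p = 1\<close>, is \<open>O(\<epsilon>)\<close>.\<close>
  define q where "q = 1 - p"
  have q: "q \<ge> 0" "q + p = 1" using False by (auto simp: q_def)
  note \<phi>' = schwartz_vderiv[OF \<phi>]
  let ?b = "if q = 0 then \<phi> 0 else 0"
  have "((\<lambda>\<epsilon>. of_real \<epsilon> * (of_real q * osc_integral s p q \<phi> \<epsilon>)) \<longlongrightarrow> 0) (at_right 0)"
  proof (cases "q = 0")
    case False
    then have "q > 0" using q by simp
    then obtain C where C: "\<And>\<epsilon>. \<epsilon> > 0 \<Longrightarrow> norm (osc_integral s p q \<phi> \<epsilon>) \<le> C * \<epsilon> powr (- q)"
      using osc_integral_bound \<phi> by blast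
    have "norm (of_real \<epsilon> * (of_real q * osc_integral s p q \<phi> \<epsilon>)) \<le> (q * C) * \<epsilon> powr p"
        if "\<epsilon> > 0" for \<epsilon>
    proof -
      have "norm (of_real \<epsilon> * (of_real q * osc_integral s p q \<phi> \<epsilon>)) \<le> \<epsilon> * (q * (C * \<epsilon> powr (- q)))"
        unfolding norm_mult using that C[OF that] q by (intro mult_mono) auto
      also have "\<dots> = q * C * \<epsilon> powr p"
        using that by (simp add: q_def powr_diff)
      finally show ?thesis .
    qed
    then show ?thesis by (rule Lim_null_powr_at_right[OF p])
  qed simp
  moreover have "((\<lambda>\<epsilon>. of_real \<epsilon> * (of_real \<epsilon> * osc_integral s p (q + 1) (vderiv \<phi>) \<epsilon>))
      \<longlongrightarrow> 0) (at_right 0)"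
  proof -
    obtain C where C: "\<And>\<epsilon>. \<epsilon> > 0 \<Longrightarrow> norm (osc_integral s p (q + 1) (vderiv \<phi>) \<epsilon>)
        \<le> C * \<epsilon> powr (- (q + 1))"
      using osc_integral_bound[of "q + 1"] \<phi>' q by (metis add_nonneg_pos zero_less_one)
    have "norm (of_real \<epsilon> * (of_real \<epsilon> * osc_integral s p (q + 1) (vderiv \<phi>) \<epsilon>)) \<le> C * \<epsilon> powr p"
        if "\<epsilon> > 0" for \<epsilon>
    proof -
      have "norm (of_real \<epsilon> * (of_real \<epsilon> * osc_integral s p (q + 1) (vderiv \<phi>) \<epsilon>))
          \<le> \<epsilon> * (\<epsilon> * (C * \<epsilon> powr (- (q + 1))))"
        unfolding norm_mult using that C[OF that] by (intro mult_mono) auto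
      also have "\<dots> = C * \<epsilon> powr p"
        using that by (simp add: q_def powr_diff power2_eq_square)
      finally show ?thesis .
    qed
    then show ?thesis by (rule Lim_null_powr_at_right[OF p])
  qed
  moreover have "((\<lambda>\<epsilon>. of_real \<epsilon> * ?b) \<longlongrightarrow> 0) (at_right 0)"
    by (rule tendsto_eq_intros refl | simp)+
  ultimately have "((\<lambda>\<epsilon>. (- (of_real \<epsilon> * ?b) - of_real \<epsilon> * (of_real q * osc_integral s p q \<phi> \<epsilon>)
      - of_real \<epsilon> * (of_real \<epsilon> * osc_integral s p (q + 1) (vderiv \<phi>) \<epsilon>)) / (of_real s * \<i> *
          of_real p)) \<longlongrightarrow>
      (- 0 - 0 - 0) / (of_real s * \<i> * of_real p)) (at_right 0)"
    using s p by (intro tendsto_intros) auto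
  moreover have "(- (of_real \<epsilon> * ?b) - of_real \<epsilon> * (of_real q * osc_integral s p q \<phi> \<epsilon>)
      - of_real \<epsilon> * (of_real \<epsilon> * osc_integral s p (q + 1) (vderiv \<phi>) \<epsilon>)) / (of_real s * \<i> *
          of_real p)
      = of_real \<epsilon> * osc_integral s p 1 \<phi> \<epsilon>" if "\<epsilon> > 0" for \<epsilon>
  proof -
    have nz: "of_real s * \<i> * of_real p \<noteq> (0 :: complex)" using s p by auto
    have "of_real \<epsilon> * osc_integral s p 1 \<phi> \<epsilon> * (of_real s * \<i> * of_real p) =
       of_real \<epsilon> * (of_real s * \<i> * of_real p * osc_integral s p (q + p) \<phi> \<epsilon>)"
      by (simp add: q mult_ac)
    also have "\<dots> = - (of_real \<epsilon> * ?b) - of_real \<epsilon> * (of_real q * osc_integral s p q \<phi> \<epsilon>)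
      - of_real \<epsilon> * (of_real \<epsilon> * osc_integral s p (q + 1) (vderiv \<phi>) \<epsilon>)"
      unfolding osc_integral_parts[OF p q(1) \<phi> that] by (simp add: algebra_simps)
    finally show ?thesis using nz by (simp add: divide_eq_eq del: mult_eq_0_iff)
  qed
  ultimately show ?thesis
    by (auto elim!: Lim_transform_eventually intro!: eventually_mono[OF
        eventually_at_right_less[of 0]])
qed

text \<open>Passage to the limit in \<open>osc_integral_parts\<close>. At \<open>q = 0\<close> the
  value \<open>I\<close> is multiplied by 0, so its convergence is asked only for
  \<open>q > 0\<close>; this lets the same statement serve the induction step and the starting case
  \<open>q = p\<close>.\<close>

lemma osc_integral_tendsto_step:
  assumes "q \<ge> 0" and \<psi>: "\<psi> \<in> schwartz"
    and I: "q > 0 \<Longrightarrow> (osc_integral s p q \<psi> \<longlongrightarrow> I) (at_right 0)"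
    and 0: "((\<lambda>\<epsilon>. of_real \<epsilon> * osc_integral s p (q + 1) (vderiv \<psi>) \<epsilon>) \<longlongrightarrow> 0) (at_right 0)"
  shows "(osc_integral s p (q + p) \<psi> \<longlongrightarrow>
      (- (if q = 0 then \<psi> 0 else 0) - of_real q * I) / (of_real s * \<i> * of_real p)) (at_right 0)"
proof -
  have nz: "of_real s * \<i> * of_real p \<noteq> (0 :: complex)" using s p by auto
  have "((\<lambda>\<epsilon>. of_real q * osc_integral s p q \<psi> \<epsilon>) \<longlongrightarrow> of_real q * I) (at_right 0)"
    using I assms(1) by (cases "q = 0") (auto intro!: tendsto_intros)
  from tendsto_divide[OF tendsto_diff[OF tendsto_diff[OF tendsto_const this] 0] tendsto_const nz]
  have "((\<lambda>\<epsilon>. (- (if q = 0 then \<psi> 0 else 0) - of_real q * osc_integral s p q \<psi> \<epsilon>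
       - of_real \<epsilon> * osc_integral s p (q + 1) (vderiv \<psi>) \<epsilon>) / (of_real s * \<i> * of_real p)) \<longlongrightarrow>
     (- (if q = 0 then \<psi> 0 else 0) - of_real q * I - 0) / (of_real s * \<i> * of_real p)) (at_right
         0)" .
  moreover have "(- (if q = 0 then \<psi> 0 else 0) - of_real q * osc_integral s p q \<psi> \<epsilon>
       - of_real \<epsilon> * osc_integral s p (q + 1) (vderiv \<psi>) \<epsilon>) / (of_real s * \<i> * of_real p)
           = osc_integral s p (q + p) \<psi> \<epsilon>"
    if "\<epsilon> > 0" for \<epsilon>
    unfolding osc_integral_parts[OF p assms(1) \<psi> that, of s, symmetric] using nz
        by (rule nonzero_mult_div_cancel_left)
  ultimately have "(osc_integral s p (q + p) \<psi> \<longlongrightarrow>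
      (- (if q = 0 then \<psi> 0 else 0) - of_real q * I - 0) / (of_real s * \<i> * of_real p)) (at_right 0)"
    by (auto elim!: Lim_transform_eventually intro!: eventually_mono[OF
        eventually_at_right_less[of 0]])
  then show ?thesis by simp
qed

text \<open>With \<open>a = q / p\<close> this is \<open>Gamma (a + 1) = a * Gamma a\<close>
  combined with the quarter turn \<open>s * \<i>\<close>, which equals
  \<open>- 1 / (s * \<i>)\<close>.\<close>

lemma fresnel_step:
  assumes "q > 0"
  shows "fresnel s (of_real p) (of_real (q + p))
      = - (of_real q * fresnel s (of_real p) (of_real q)) / (of_real s * \<i> * of_real p)"
proof -
  have *: "of_real (q + p) / of_real p = (of_real (q / p) + 1 :: complex)"
    using p by (simp add: field_simps)
  have "0 < q / p" using assms p by simp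
  then have "q / p \<notin> \<int>\<^sub>\<le>\<^sub>0"
    using nonpos_Ints_nonpos by fastforce
  then have "Gamma (of_real (q / p) + 1 :: complex) = of_real (q / p) * Gamma (of_real (q / p))"
    by (intro Gamma_plus1) (simp only: of_real_in_nonpos_Ints_iff not_False_eq_True)
  moreover have "exp (of_real s * \<i> * of_real (pi / 2) * (of_real (q / p) + 1))
      = of_real s * \<i> * exp (of_real s * \<i> * of_real (pi / 2) * of_real (q / p))"
    by (simp only: distrib_left mult_1_right exp_add exp_quarter_turn[OF s]) (rule mult.commute)
  ultimately show ?thesis
    using s p unfolding fresnel_def * by (auto simp: field_simps)
qed

text \<open>Uses \<open>Gamma 1 = 1\<close>; the right side is the coefficient of
  \<open>\<psi> 0\<close> left by \<open>osc_integral_tendsto_step\<close> at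
  \<open>q = 0\<close>.\<close>

lemma fresnel_diag: "fresnel s (of_real p) (of_real p) = - 1 / (of_real s * \<i> * of_real p)"
  using s p exp_quarter_turn[OF s] by (auto simp: fresnel_def field_simps)

text \<open>Induction on the number of steps of length \<open>p\<close>. The cutoff is generalised
  because the induction hypothesis is applied twice: to \<psi> for the main term and to
  \<open>x * \<psi>'\<close> for the remainder.\<close>

lemma osc_integral_tendsto:
  assumes "q > 0" "\<psi> \<in> schwartz"
  shows "(osc_integral s p q \<psi> \<longlongrightarrow> fresnel s (of_real p) (of_real q) * \<psi> 0) (at_right 0)"
proof -
  have "(osc_integral s p q \<psi> \<longlongrightarrow> fresnel s (of_real p) (of_real q) * \<psi> 0) (at_right 0)"
    if "0 < q" "q \<le> p * real (Suc n)" "\<psi> \<in> schwartz" for n q \<psi>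
    using that
  proof (induction n arbitrary: q \<psi>)
    case 0
    show ?case
    proof (cases "q = p")
      case True
      \<comment> \<open>Rotation gives no decay for \<open>a = 1\<close>. The value comes from the
        boundary term at 0, and the Riemann-Lebesgue statement removes the remainder.\<close>
      then show ?thesis
        using osc_integral_tendsto_step[of 0 \<psi>, OF _ 0(3)] osc_integral_1_tendsto[OF
            schwartz_vderiv[OF 0(3)]]
        by (simp add: fresnel_diag)
    qed (use 0 osc_integral_tendsto_less in auto)
  next
    case (Suc n)
    show ?case
    proof (cases "q \<le> p * real (Suc n)")
      case False
      have "p * 1 \<le> p * real (Suc n)"
        using p by (intro mult_left_mono) auto
      then have "p * 1 < q"
        using False by (meson not_le order_le_less_trans)
      then have q: "q - p > 0" "q - p \<le> p * real (Suc n)"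
        using Suc.prems(2) by (auto simp: distrib_left)
      note \<psi>' = schwartz_vderiv[OF Suc.prems(3)]
      \<comment> \<open>The new cutoff vanishes at 0, which makes its limit 0; absorbing \<epsilon>
        identifies this integral with the remainder.\<close>
      have "(osc_integral s p (q - p) (\<lambda>x. x *\<^sub>R vderiv \<psi> x) \<longlongrightarrow> 0) (at_right 0)"
        using Suc.IH[OF q schwartz_scaleR_id[OF \<psi>']] by simp
      then have "((\<lambda>\<epsilon>. of_real \<epsilon> * osc_integral s p (q - p + 1) (vderiv \<psi>) \<epsilon>) \<longlongrightarrow> 0) (at_right 0)"
        by (auto elim!: Lim_transform_eventually intro!: eventually_mono[OF
            eventually_at_right_less[of 0]]
          simp: osc_integral_scaleR_id)
      from osc_integral_tendsto_step[OF _ Suc.prems(3) Suc.IH[OF q Suc.prems(3)] this] q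
          fresnel_step[OF q(1)]
      show ?thesis by (simp add: algebra_simps)
    qed (use Suc in auto)
  qed
  moreover obtain n where "q / p \<le> real n" using real_arch_simple by blast
  then have "q \<le> p * real (Suc n)" using p by (simp add: field_simps)
  ultimately show ?thesis using assms by blast
qed

lemma has_Os_integral_fresnel:
  assumes "q > 0"
  shows "has_Os_integral (fresnel_integrand s p q) (fresnel s (of_real p) (of_real q))"
  unfolding has_Os_integral_def
proof (intro ballI impI conjI allI)
  fix \<psi> assume \<psi>: "\<psi> \<in> schwartz" "\<psi> 0 = 1"
  note i = osc_integrable[OF assms \<psi>(1), of _ s p]
  show "(\<lambda>x. fresnel_integrand s p q x * \<psi> (\<epsilon> * x)) integrable_on {0<..}" if "0 < \<epsilon> \<and> \<epsilon> < 1" for \<epsilon>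
    using set_borel_integral_eq_integral(1)[OF i] that by blast
  have "osc_integral s p q \<psi> \<epsilon> = integral {0<..} (\<lambda>x. fresnel_integrand s p q x * \<psi> (\<epsilon> * x))"
      if "\<epsilon> > 0" for \<epsilon>
    unfolding osc_integral_def by (rule set_borel_integral_eq_integral(2)[OF i[OF that]])
  then show "((\<lambda>\<epsilon>. integral {0<..} (\<lambda>x. fresnel_integrand s p q x * \<psi> (\<epsilon> * x)))
      \<longlongrightarrow> fresnel s (of_real p) (of_real q)) (at_right 0)"
    using osc_integral_tendsto[OF assms \<psi>(1)] \<psi>(2)
    by (auto elim!: Lim_transform_eventually intro!: eventually_mono[OF
        eventually_at_right_less[of 0]])
qed

end

text \<open>The pole of \<open>Gamma\<close> at 0 adds \<open>q = 0\<close> to the points with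
  \<open>j \<ge> 1\<close>. In \<open>p\<close>, deleting 0 on the right empties the set when
  \<open>q = 0\<close>, in accordance with the function being identically 0 there.\<close>

theorem theorem4p2:
  fixes s :: real
  assumes "s = 1 \<or> s = - 1"
  shows
    "(\<forall>p q :: real. 0 < p \<and> 0 < q \<longrightarrow>
        has_Os_integral (fresnel_integrand s p q)
          (inverse (of_real p) * exp (of_real s * \<i> * of_real (pi / 2) * of_real (q / p))
             * Gamma (of_real (q / p))))
     \<and>
     (\<exists>F. is_fresnel_continuation s F \<and>
        (\<forall>p. p \<noteq> 0 \<longrightarrow>
           (\<forall>q. \<not> is_pole (\<lambda>q. F p q) q \<longrightarrow> F p q \<noteq> 0) \<and>
           {q. is_pole (\<lambda>q. F p q) q} = insert 0 {- p * of_nat j | j :: nat. 1 \<le> j} \<and>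
           (\<forall>q. is_pole (\<lambda>q. F p q) q \<longrightarrow> zorder (\<lambda>q. F p q) q = - 1)) \<and>
        (\<forall>q.
           {p \<in> - {0}. is_pole (\<lambda>p. F p q) p} = {- q / of_nat j | j :: nat. 1 \<le> j} - {0} \<and>
           (\<forall>p \<in> - {0}. is_pole (\<lambda>p. F p q) p \<longrightarrow> zorder (\<lambda>p. F p q) p = - 1)))"
proof (intro conjI exI[of _ "fresnel s"] allI impI ballI)
  fix p q :: real assume "0 < p \<and> 0 < q"
  then show "has_Os_integral (fresnel_integrand s p q)
          (inverse (of_real p) * exp (of_real s * \<i> * of_real (pi / 2) * of_real (q / p))
             * Gamma (of_real (q / p)))"
    using has_Os_integral_fresnel[OF assms, of p q] by (simp only: of_real_fresnel)
next
  show "is_fresnel_continuation s (fresnel s)"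
    unfolding is_fresnel_continuation_def using has_Os_integral_fresnel[OF assms]
        fresnel_nicely_meromorphic by blast
next
  fix p :: complex assume p: "p \<noteq> 0"
  have "(\<exists>j::nat. q = - p * of_nat j) \<longleftrightarrow> q = 0 \<or> (\<exists>j::nat. q = - p * of_nat j \<and> 1 \<le> j)" for q
    by (metis less_one mult_zero_right not_le of_nat_0)
  then show "{q. is_pole (\<lambda>q. fresnel s p q) q} = insert 0 {- p * of_nat j | j :: nat. 1 \<le> j}"
    unfolding fresnel_pole_q(1)[OF p] by blast
next
  fix q :: complex
  \<comment> \<open>In one direction \<open>q \<noteq> 0\<close> rules out \<open>j = 0\<close>; in
    the other, \<open>p \<noteq> 0\<close> forces \<open>q \<noteq> 0\<close>.\<close>
  have "q \<noteq> 0 \<and> (\<exists>j::nat. q = - p * of_nat j) \<longleftrightarrow> (\<exists>j::nat. p = - q / of_nat j \<and> 1 \<le> j)"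
    if "p \<noteq> 0" for p
  proof
    assume "q \<noteq> 0 \<and> (\<exists>j::nat. q = - p * of_nat j)"
    then obtain j :: nat where "q \<noteq> 0" "q = - p * of_nat j" by blast
    then show "\<exists>j::nat. p = - q / of_nat j \<and> 1 \<le> j"
      by (intro exI[of _ j]) (cases j; simp)
  next
    assume "\<exists>j::nat. p = - q / of_nat j \<and> 1 \<le> j"
    then obtain j :: nat where "p = - q / of_nat j" "1 \<le> j" by blast
    then show "q \<noteq> 0 \<and> (\<exists>j::nat. q = - p * of_nat j)"
      using that by (intro conjI exI[of _ j]) auto
  qed
  then have "{p \<in> - {0}. is_pole (\<lambda>p. fresnel s p q) p} = {p \<in> - {0}. \<exists>j::nat. p
      = - q / of_nat j \<and> 1 \<le> j}"
    by (intro Collect_cong conj_cong refl) (simp only: fresnel_pole_p(1) Compl_iff singleton_iff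
        simp_thms)
  then show "{p \<in> - {0}. is_pole (\<lambda>p. fresnel s p q) p} = {- q / of_nat j | j :: nat. 1 \<le> j} - {0}"
    by blast
qed (use fresnel_pole_q(2,3) fresnel_pole_p(2) in auto)

end
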